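(* Let $G$ be a graph which is a complete intersection. Then either (a) there exists a vertex of $G$ of degree $\le 2$, or (b) $G$ is $3$-regular, $b(G\setminus\{v\})=0$ for every $v\in V(G)$, and $P_G$ is generated by quadrics.
   Context: Graphs are finite, simple (no loops, no multiple edges) and undirected. Let $k$ be an arbitrary field. For a graph $G$ with $V(G)=\{v_1,\ldots,v_m\}$ and $E(G)=\{e_1,\ldots,e_n\}$, the toric ideal $P_G$ of $G$ is the kernel of the $k$-algebra homomorphism $k[x_1,\ldots,x_n]\to k[t_1,\ldots,t_m]$ with $x_i\mapsto t_jt_l$ whenever $e_i=\{v_j,v_l\}$. $G$ is a complete intersection if $\mu(P_G)=\mathrm{ht}(P_G)$, where $\mu(P_G)$ is the minimal number of generators of $P_G$ (if $P_G=0$ both numbers are $0$). $G\setminus\{v\}$ denotes the induced subgraph on $V(G)\setminus\{v\}$. $b(H)$ is the number of connected components of $H$ that are bipartite (an isolated vertex is a bipartite component). $G$ is $3$-regular if every vertex has degree $3$. A quadric is a polynomial in $k[x_1,\ldots,x_n]$ that is homogeneous of degree $2$ in the variables $x_i$. *)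

theory Defs
  imports
    "HOL-Algebra.RingHom"
    "HOL-Library.Poly_Mapping"
    "HOL-Library.Extended_Nat"
begin

section \<open>Polynomial rings\<close>

text \<open>
  A polynomial over \<open>'k\<close> is a finitely supported map from monomials to coefficients, and a monomial
  is a finitely supported map from variables to exponents; the library's convolution product on
  \<^typ>\<open>('i \<Rightarrow>\<^sub>0 nat) \<Rightarrow>\<^sub>0 'k\<close> is the product of polynomials.
\<close>

type_synonym ('i, 'k) mpoly = "('i \<Rightarrow>\<^sub>0 nat) \<Rightarrow>\<^sub>0 'k"

definition mvar :: "'i \<Rightarrow> ('i, 'k::field) mpoly" where
  "mvar i = Poly_Mapping.single (Poly_Mapping.single i 1) 1"

definition mconst :: "'k::field \<Rightarrow> ('i, 'k) mpoly" where
  "mconst c = Poly_Mapping.single 0 c"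

text \<open>Only the variables in \<open>X\<close> may occur, so this is \<open>k[x\<^sub>i | i \<in> X]\<close>.\<close>

definition mpoly_ring :: "'i set \<Rightarrow> ('i, 'k::field) mpoly ring" where
  "mpoly_ring X = \<lparr>carrier = {p. \<forall>m\<in>Poly_Mapping.keys p. Poly_Mapping.keys m \<subseteq> X},
     mult = (*), one = 1, zero = 0, add = (+)\<rparr>"

text \<open>The \<open>k\<close>-algebra homomorphism that maps the variable \<open>i\<close> to \<open>f i\<close>.\<close>

definition mpoly_subst :: "('i \<Rightarrow> ('j, 'k) mpoly) \<Rightarrow> ('i, 'k::field) mpoly \<Rightarrow> ('j, 'k) mpoly" where
  "mpoly_subst f p = (\<Sum>m\<in>Poly_Mapping.keys p. mconst (Poly_Mapping.lookup p m) *
     (\<Prod>i\<in>Poly_Mapping.keys m. f i ^ Poly_Mapping.lookup m i))"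

definition quadric :: "('i, 'k::field) mpoly \<Rightarrow> bool" where
  "quadric p \<longleftrightarrow> (\<forall>m\<in>Poly_Mapping.keys p. (\<Sum>i\<in>Poly_Mapping.keys m. Poly_Mapping.lookup m i) = 2)"

lemma cring_mpoly_ring: "cring (mpoly_ring X :: ('i, 'k::field) mpoly ring)"
proof -
  let ?R = "mpoly_ring X :: ('i, 'k) mpoly ring"
  have add: "p + q \<in> carrier ?R" if "p \<in> carrier ?R" "q \<in> carrier ?R" for p q
    using that keys_add[of p q] by (auto simp: mpoly_ring_def)
  have uminus: "- p \<in> carrier ?R" if "p \<in> carrier ?R" for p
    using that by (auto simp: mpoly_ring_def in_keys_iff)
  have mult: "p * q \<in> carrier ?R" if "p \<in> carrier ?R" "q \<in> carrier ?R" for p q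
  proof -
    have "Poly_Mapping.keys m \<subseteq> X" if m: "m \<in> Poly_Mapping.keys (p * q)" for m
    proof -
      obtain a b where "m = a + b" "a \<in> Poly_Mapping.keys p" "b \<in> Poly_Mapping.keys q"
        using keys_mult[of p q] m by auto
      then show ?thesis
        using \<open>p \<in> carrier ?R\<close> \<open>q \<in> carrier ?R\<close> keys_add[of a b]
        by (force simp: mpoly_ring_def)
    qed
    then show ?thesis by (auto simp: mpoly_ring_def)
  qed
  have closed: "0 \<in> carrier ?R" "1 \<in> carrier ?R"
    by (simp_all add: mpoly_ring_def)
  have ops: "x \<oplus>\<^bsub>?R\<^esub> y = x + y" "x \<otimes>\<^bsub>?R\<^esub> y = x * y" "\<zero>\<^bsub>?R\<^esub> = 0" "\<one>\<^bsub>?R\<^esub> = 1" for x y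
    by (simp_all add: mpoly_ring_def)
  show ?thesis
  proof (rule cringI)
    show "abelian_group ?R"
    proof (rule abelian_groupI)
      fix x assume "x \<in> carrier ?R"
      then show "\<exists>y\<in>carrier ?R. y \<oplus>\<^bsub>?R\<^esub> x = \<zero>\<^bsub>?R\<^esub>"
        using uminus by (intro bexI[of _ "- x"]) (auto simp: ops)
    qed (simp_all add: ops closed add ac_simps)
    show "comm_monoid ?R"
      by (rule comm_monoidI) (simp_all add: ops closed mult ac_simps)
  qed (simp add: ops distrib_right)
qed

lemma mpoly_subst_cong_keys:
  assumes "finite A" "Poly_Mapping.keys p \<subseteq> A"
  shows "mpoly_subst f p = (\<Sum>m\<in>A. mconst (Poly_Mapping.lookup p m) *
     (\<Prod>i\<in>Poly_Mapping.keys m. f i ^ Poly_Mapping.lookup m i))"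
  unfolding mpoly_subst_def
  by (rule sum.mono_neutral_left) (use assms in \<open>auto simp: in_keys_iff mconst_def\<close>)

lemma mpoly_subst_add: "mpoly_subst f (p + q) = mpoly_subst f p + mpoly_subst f q"
proof -
  let ?A = "Poly_Mapping.keys p \<union> Poly_Mapping.keys q"
  show ?thesis
    using keys_add[of p q]
    by (simp add: mpoly_subst_cong_keys[of ?A] lookup_add mconst_def single_add
        distrib_right sum.distrib)
qed

lemma mpoly_subst_single:
  "mpoly_subst f (Poly_Mapping.single m c) =
     mconst c * (\<Prod>i\<in>Poly_Mapping.keys m. f i ^ Poly_Mapping.lookup m i)"
  by (cases "c = 0") (simp_all add: mpoly_subst_def mconst_def)

lemma mpoly_subst_const: "mpoly_subst f (mconst c) = mconst c"
  by (simp add: mconst_def mpoly_subst_single)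

lemma mpoly_subst_var: "mpoly_subst f (mvar i) = f i"
  by (simp add: mvar_def mpoly_subst_single mconst_def)

lemma mpoly_subst_sum: "mpoly_subst f (sum g A) = (\<Sum>a\<in>A. mpoly_subst f (g a))"
  by (induction A rule: infinite_finite_induct) (simp_all add: mpoly_subst_add, simp_all add: mpoly_subst_def)

lemma mpoly_expand: 
  "p = (\<Sum>m\<in>Poly_Mapping.keys p. Poly_Mapping.single m (Poly_Mapping.lookup p m))"
  by (rule poly_mapping_eqI) (auto simp: lookup_sum lookup_single when_def sum.delta in_keys_iff)

lemma mpoly_subst_single_mult:
  "mpoly_subst f (Poly_Mapping.single m c * Poly_Mapping.single n d) =
     mpoly_subst f (Poly_Mapping.single m c) * mpoly_subst f (Poly_Mapping.single n d)"
  for f :: "'i \<Rightarrow> ('j, 'k::field) mpoly"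
proof -
  let ?A = "Poly_Mapping.keys m \<union> Poly_Mapping.keys n"
  have ext: "(\<Prod>i\<in>Poly_Mapping.keys l. f i ^ Poly_Mapping.lookup l i) =
      (\<Prod>i\<in>?A. f i ^ Poly_Mapping.lookup l i)" if "Poly_Mapping.keys l \<subseteq> ?A" for l
    by (rule prod.mono_neutral_left) (use that in \<open>auto simp: in_keys_iff\<close>)
  have "(\<Prod>i\<in>Poly_Mapping.keys (m + n). f i ^ Poly_Mapping.lookup (m + n) i) =
      (\<Prod>i\<in>Poly_Mapping.keys m. f i ^ Poly_Mapping.lookup m i) *
      (\<Prod>i\<in>Poly_Mapping.keys n. f i ^ Poly_Mapping.lookup n i)"
    unfolding ext[OF keys_add] ext[OF Un_upper1] ext[OF Un_upper2]
    by (simp add: lookup_add power_add prod.distrib)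
  moreover have "mconst (c * d) = (mconst c * mconst d :: ('j, 'k) mpoly)"
    by (simp add: mconst_def mult_single)
  ultimately show ?thesis
    by (simp add: mult_single mpoly_subst_single algebra_simps)
qed

lemma mpoly_subst_mult: "mpoly_subst f (p * q) = mpoly_subst f p * mpoly_subst f q"
proof -
  let ?s = "\<lambda>p. \<Sum>m\<in>Poly_Mapping.keys p. Poly_Mapping.single m (Poly_Mapping.lookup p m)"
  have "mpoly_subst f (?s p * ?s q) = mpoly_subst f (?s p) * mpoly_subst f (?s q)"
    by (simp only: sum_product mpoly_subst_sum mpoly_subst_single_mult)
  then show ?thesis
    by (simp only: mpoly_expand[symmetric])
qed

section \<open>Height and minimal number of generators of an ideal\<close>

definition prime_height :: "('a, 'b) ring_scheme \<Rightarrow> 'a set \<Rightarrow> enat" where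
  "prime_height R P = Sup {enat h | h. \<exists>C :: nat \<Rightarrow> 'a set.
     (\<forall>i\<le>h. primeideal (C i) R) \<and> (\<forall>i<h. C i \<subset> C (Suc i)) \<and> C h = P}"

definition ideal_height :: "('a, 'b) ring_scheme \<Rightarrow> 'a set \<Rightarrow> enat" where
  "ideal_height R I = Inf {prime_height R P | P. primeideal P R \<and> I \<subseteq> P}"

definition min_generators :: "('a, 'b) ring_scheme \<Rightarrow> 'a set \<Rightarrow> enat" where
  "min_generators R I = Inf {enat (card S) | S. finite S \<and> S \<subseteq> carrier R \<and> Idl\<^bsub>R\<^esub> S = I}"

section \<open>Graphs\<close>

text \<open>
  A graph is given by its vertex set \<open>V\<close> and its edge set \<open>E\<close>, an edge being the set of its two ends.
\<close>

definition simple_graph :: "'a set \<Rightarrow> 'a set set \<Rightarrow> bool" where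
  "simple_graph V E \<longleftrightarrow> finite V \<and> E \<subseteq> {{u, w} | u w. u \<in> V \<and> w \<in> V \<and> u \<noteq> w}"

definition vertex_degree :: "'a set set \<Rightarrow> 'a \<Rightarrow> nat" where
  "vertex_degree E v = card {e \<in> E. v \<in> e}"

definition regular_graph :: "nat \<Rightarrow> 'a set \<Rightarrow> 'a set set \<Rightarrow> bool" where
  "regular_graph d V E \<longleftrightarrow> (\<forall>v\<in>V. vertex_degree E v = d)"

definition induced_edges :: "'a set set \<Rightarrow> 'a set \<Rightarrow> 'a set set" where
  "induced_edges E W = {e \<in> E. e \<subseteq> W}"

definition bipartite_graph :: "'a set \<Rightarrow> 'a set set \<Rightarrow> bool" where
  "bipartite_graph V E \<longleftrightarrow> (\<exists>A B. A \<union> B = V \<and> A \<inter> B = {} \<and> (\<forall>e\<in>E. \<exists>a\<in>A. \<exists>b\<in>B. e = {a, b}))"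

text \<open>
  Components are represented by their vertex sets; in a simple graph the edges stay inside \<open>V\<close>, so the
  classes of vertices of \<open>V\<close> do as well.
\<close>

definition graph_components :: "'a set \<Rightarrow> 'a set set \<Rightarrow> 'a set set" where
  "graph_components V E = V // {(u, w). {u, w} \<in> E}\<^sup>*"

definition num_bipartite_components :: "'a set \<Rightarrow> 'a set set \<Rightarrow> nat" where
  "num_bipartite_components V E = card {C \<in> graph_components V E. bipartite_graph C (induced_edges E C)}"

section \<open>Toric ideals of graphs\<close>

text \<open>
  The variables of the source ring are the edges themselves and those of the target ring are the
  vertices, so no enumeration of \<open>V\<close> and \<open>E\<close> is needed.
\<close>

definition toric_map :: "('a set, 'k::field) mpoly \<Rightarrow> ('a, 'k) mpoly" where
  "toric_map = mpoly_subst (\<lambda>e. \<Prod>v\<in>e. mvar v)"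

definition toric_ideal :: "'a set \<Rightarrow> 'a set set \<Rightarrow> ('a set, 'k::field) mpoly set" where
  "toric_ideal V E = a_kernel (mpoly_ring E) (mpoly_ring V) toric_map"

definition complete_intersection :: "'k::field itself \<Rightarrow> 'a set \<Rightarrow> 'a set set \<Rightarrow> bool" where
  "complete_intersection _ V E \<longleftrightarrow>
     min_generators (mpoly_ring E) (toric_ideal V E :: ('a set, 'k) mpoly set) =
     ideal_height (mpoly_ring E) (toric_ideal V E :: ('a set, 'k) mpoly set)"

lemma toric_map_ring_hom:
  assumes "simple_graph V E"
  shows "toric_map \<in> ring_hom (mpoly_ring E) (mpoly_ring V :: ('a, 'k::field) mpoly ring)"
proof (rule ring_hom_memI)
  let ?R = "mpoly_ring V :: ('a, 'k) mpoly ring"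
  interpret R: cring ?R by (rule cring_mpoly_ring)
  have mult: "p * q \<in> carrier ?R" if "p \<in> carrier ?R" "q \<in> carrier ?R" for p q
    using R.m_closed[OF that] by (simp add: mpoly_ring_def)
  have one: "1 \<in> carrier ?R"
    using R.one_closed by (simp add: mpoly_ring_def)
  have pow: "p ^ n \<in> carrier ?R" if "p \<in> carrier ?R" for p n
    by (induction n) (auto intro: one mult that)
  have prods: "prod g A \<in> carrier ?R" if "\<And>x. x \<in> A \<Longrightarrow> g x \<in> carrier ?R" for g and A :: "'b set"
    using that by (induction A rule: infinite_finite_induct) (auto intro: one mult)
  have add: "p + q \<in> carrier ?R" if "p \<in> carrier ?R" "q \<in> carrier ?R" for p q
    using R.a_closed[OF that] by (simp add: mpoly_ring_def)
  have zero: "0 \<in> carrier ?R"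
    by (simp add: mpoly_ring_def)
  have sums: "sum g A \<in> carrier ?R" if "\<And>x. x \<in> A \<Longrightarrow> g x \<in> carrier ?R" for g and A :: "'b set"
    using that by (induction A rule: infinite_finite_induct) (auto intro: zero add)
  have const: "mconst c \<in> carrier ?R" for c
    by (auto simp: mconst_def mpoly_ring_def)
  have var: "mvar v \<in> carrier ?R" if "v \<in> V" for v
    using that by (auto simp: mvar_def mpoly_ring_def)
  fix p :: "('a set, 'k) mpoly" assume p: "p \<in> carrier (mpoly_ring E)"
  have "e \<subseteq> V" if "m \<in> Poly_Mapping.keys p" "e \<in> Poly_Mapping.keys m" for m e
    using p that assms by (fastforce simp: mpoly_ring_def simple_graph_def)
  then show "toric_map p \<in> carrier ?R"
    unfolding toric_map_def mpoly_subst_def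
    by (intro sums mult const prods pow var) auto
next
  have "mpoly_subst f (1 :: ('a set, 'k) mpoly) = 1" for f :: "'a set \<Rightarrow> ('a, 'k) mpoly"
    using mpoly_subst_const[of f 1] by (simp add: mconst_def)
  then show "toric_map \<one>\<^bsub>mpoly_ring E\<^esub> = \<one>\<^bsub>mpoly_ring V :: ('a, 'k) mpoly ring\<^esub>"
    by (simp add: mpoly_ring_def toric_map_def)
qed (auto simp: mpoly_ring_def toric_map_def mpoly_subst_add mpoly_subst_mult)

lemma toric_map_edge:
  assumes "u \<noteq> w"
  shows "toric_map (mvar {u, w}) = mvar u * mvar w"
  using assms by (simp add: toric_map_def mpoly_subst_var)

end

theory Submission
  imports Defs
begin

text \<open>
  Let \<open>n\<close> and \<open>m\<close> be the numbers of edges and vertices, and let \<open>r\<close> be the rank over the rationals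
  of the \<open>n\<close> incidence vectors in the space of functions on the vertices. The toric ideal \<open>P\<close> is
  spanned by the binomials \<open>x\<^sup>a - x\<^sup>b\<close> for which \<open>a\<close> and \<open>b\<close> induce the same degree at every vertex.

  The height of \<open>P\<close> is at most \<open>n - r\<close> (\<open>ideal_height_toric_le\<close>). Hence for a complete
  intersection \<open>P\<close> has at most \<open>n - r\<close> generators, and by graded Nakayama they may be replaced by a
  set \<open>S\<close> of no more binomials, none of which is a combination of proper monomial multiples of
  binomials in \<open>P\<close>
  (\<open>minimal_binomial_generators\<close>). The binomials of \<open>S\<close> that avoid a vertex \<open>v\<close> generate the toric
  ideal of the graph without \<open>v\<close> (\<open>toric_set_delete_vertex\<close>). If \<open>r\<^sub>v\<close> is the rank for that graph,
  there are at least \<open>n - deg v - r\<^sub>v\<close> of them, because the differences \<open>a - b\<close> of exponents span the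
  relations between the incidence vectors (\<open>card_edges_le_generators\<close>). So at most
  \<open>deg v - (r - r\<^sub>v)\<close> binomials of \<open>S\<close> meet \<open>v\<close>, which is at most \<open>deg v - 1\<close> as soon as \<open>v\<close> has an
  edge. On the other hand every nonzero binomial meets at least four vertices
  (\<open>four_le_card_binomial_vertices\<close>). Counting pairs of a binomial in \<open>S\<close> and a vertex that it meets
  gives, if every vertex has an edge,
  \<open>4 (n - r) \<le> 4 |S| \<le> \<Sum>\<^sub>v (deg v - 1) = 2 n - m\<close>,
  and \<open>r \<le> m\<close> turns this into \<open>2 n \<le> 3 m\<close>.

  If all degrees are at least \<open>3\<close>, then \<open>2 n \<ge> 3 m\<close>, so equality holds throughout. This says that
  all degrees are \<open>3\<close>; that each binomial in \<open>S\<close> meets exactly four vertices, and then minimality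
  forces it to have degree \<open>2\<close> (\<open>binomial_on_four_vertices\<close>); and that \<open>r\<^sub>v = m - 1\<close>, so that the
  incidence vectors of the graph without \<open>v\<close> span the whole space. The latter excludes bipartite
  components, since the signs of a bipartition would be a functional that vanishes on all incidence
  vectors (\<open>no_bipartite_component\<close>).
\<close>

abbreviation keys :: "('x \<Rightarrow>\<^sub>0 'b::zero) \<Rightarrow> 'x set" where "keys \<equiv> Poly_Mapping.keys"
abbreviation lookup :: "('x \<Rightarrow>\<^sub>0 'b::zero) \<Rightarrow> 'x \<Rightarrow> 'b" where "lookup \<equiv> Poly_Mapping.lookup"
abbreviation single :: "'x \<Rightarrow> 'b \<Rightarrow> ('x \<Rightarrow>\<^sub>0 'b::zero)" where "single \<equiv> Poly_Mapping.single"

section \<open>Finitely supported maps as vectors\<close>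
definition pm_scale :: "'k \<Rightarrow> ('x \<Rightarrow>\<^sub>0 'k) \<Rightarrow> ('x \<Rightarrow>\<^sub>0 'k::field)" where
  "pm_scale c p = Poly_Mapping.map ((*) c) p"

lemma lookup_pm_scale [simp]: "lookup (pm_scale c p) x = c * lookup p x"
  by (auto simp: pm_scale_def map.rep_eq when_def)

interpretation pm: vector_space "pm_scale :: 'k::field \<Rightarrow> ('x \<Rightarrow>\<^sub>0 'k) \<Rightarrow> ('x \<Rightarrow>\<^sub>0 'k)"
  by unfold_locales (auto intro!: poly_mapping_eqI simp: lookup_add algebra_simps)

lemma mconst_mult: "mconst c * p = pm_scale c p"
  by (simp add: mconst_def pm_scale_def mult_map_scale_conv_mult)

lemma pm_scale_single [simp]: "pm_scale c (single x d) = single x (c * d)"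
  by (rule poly_mapping_eqI) (simp add: lookup_single when_def)

lemma pm_scale_mult_left: "pm_scale c p * q = pm_scale c (p * q)"
  for p :: "('i, 'k::field) mpoly"
  by (simp add: mconst_mult[symmetric] mult.assoc)

lemma pm_scale_mult_right: "p * pm_scale c q = pm_scale c (p * q)"
  for p :: "('i, 'k::field) mpoly"
  by (simp add: mconst_mult[symmetric] mult_ac)

lemma independent_image_if_scalars_zero:
  assumes "finite I"
    and zero: "\<And>c i. (\<Sum>i\<in>I. pm_scale (c i) (g i)) = 0 \<Longrightarrow> i \<in> I \<Longrightarrow> c i = 0"
  shows "inj_on g I" "pm.independent (g ` I)"
proof -
  show inj: "inj_on g I"
  proof (rule inj_onI, rule ccontr)
    fix i j assume ij: "i \<in> I" "j \<in> I" "g i = g j" "i \<noteq> j"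
    \<comment> \<open>Equal vectors at distinct indices satisfy the relation \<open>g i - g j = 0\<close>.\<close>
    let ?c = "\<lambda>l. if l = i then 1 else if l = j then -1 else 0"
    have "(\<Sum>l\<in>I. pm_scale (?c l) (g l)) = (\<Sum>l\<in>{i,j}. pm_scale (?c l) (g l))"
      using ij \<open>finite I\<close> by (intro sum.mono_neutral_right) auto
    also have "\<dots> = 0" using ij by simp
    finally show False using zero[of ?c i] ij(1) by simp
  qed
  show "pm.independent (g ` I)"
  proof (rule pm.independent_if_scalars_zero)
    fix f x assume "(\<Sum>x\<in>g ` I. pm_scale (f x) x) = 0" "x \<in> g ` I"
    then show "f x = 0"
      using zero[of "f \<circ> g"] by (auto simp: sum.reindex[OF inj])
  qed (use \<open>finite I\<close> in simp)
qed

text \<open>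
  Extends a weight function on the index set linearly. The weights that occur are indicators of sets
  of monomials, for polynomials, and indicators of sets of edges, for monomials.
\<close>
definition wsum :: "('x \<Rightarrow> 'b) \<Rightarrow> ('x \<Rightarrow>\<^sub>0 'b) \<Rightarrow> 'b::comm_semiring_1" where
  "wsum w p = (\<Sum>x\<in>keys p. lookup p x * w x)"

lemma wsum_superset: "finite A \<Longrightarrow> keys p \<subseteq> A \<Longrightarrow> wsum w p = (\<Sum>x\<in>A. lookup p x * w x)"
  unfolding wsum_def by (rule sum.mono_neutral_left) (auto simp: in_keys_iff)

lemma wsum_zero [simp]: "wsum w 0 = 0"
  by (simp add: wsum_def)

lemma wsum_add: "wsum w (p + q) = wsum w p + wsum w q"
  using keys_add[of p q]
  by (simp add: wsum_superset[of "keys p \<union> keys q"] lookup_add distrib_right sum.distrib)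

lemma wsum_single [simp]: "wsum w (single x c) = c * w x"
  by (simp add: wsum_def)

lemma wsum_sum: "wsum w (sum f A) = (\<Sum>a\<in>A. wsum w (f a))"
  by (induction A rule: infinite_finite_induct) (auto simp: wsum_add)

lemma wsum_diff: "wsum w (p - q) = wsum w p - wsum w q" for p :: "'x \<Rightarrow>\<^sub>0 'b::comm_ring_1"
  using wsum_add[of w "p - q" q] by (simp add: algebra_simps)

lemma wsum_scale: "wsum w (pm_scale c p) = c * wsum w p"
proof -
  have "keys (pm_scale c p) \<subseteq> keys p" by (auto simp: in_keys_iff)
  then show ?thesis
    by (subst wsum_superset[of "keys p"]) (auto simp: wsum_def sum_distrib_left mult_ac)
qed

lemma wsum_monomial_mult: "wsum w (single m 1 * p) = wsum (\<lambda>n. w (m + n)) p"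
  for p :: "('i, 'k::field) mpoly"
proof -
  have "single m 1 * p = (\<Sum>n\<in>keys p. single (m + n) (lookup p n))"
    by (subst mpoly_expand[of p]) (simp add: sum_distrib_left mult_single)
  then show ?thesis by (simp add: wsum_sum) (simp add: wsum_def)
qed

lemma subspace_wsum: "pm.subspace {p. wsum w p = 0}"
  by (rule pm.subspaceI) (auto simp: wsum_add wsum_scale)

definition pm_filter :: "('x \<Rightarrow> bool) \<Rightarrow> ('x \<Rightarrow>\<^sub>0 'b) \<Rightarrow> ('x \<Rightarrow>\<^sub>0 'b::zero)" where
  "pm_filter D p = Poly_Mapping.mapp (\<lambda>x c. if D x then c else 0) p"

lemma lookup_pm_filter [simp]: "lookup (pm_filter D p) x = (if D x then lookup p x else 0)"
  by (auto simp: pm_filter_def lookup_mapp when_def in_keys_iff)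

lemma pm_filter_diff: "pm_filter D (p - q) = pm_filter D p - pm_filter D q"
  for p :: "'x \<Rightarrow>\<^sub>0 'b::ab_group_add"
  by (rule poly_mapping_eqI) (simp add: lookup_minus)

lemma pm_filter_single [simp]: "pm_filter D (single x c) = (if D x then single x c else 0)"
  by (rule poly_mapping_eqI) (auto simp: lookup_single when_def)

text \<open>
  Truncation is linear, so membership of truncated elements needs to be checked on a spanning set only.
\<close>
lemma pm_filter_in_subspace:
  fixes p :: "'a \<Rightarrow>\<^sub>0 'b::field"
  assumes p: "p \<in> pm.span S" and U: "pm.subspace U" and S: "\<And>s. s \<in> S \<Longrightarrow> pm_filter D s \<in> U"
  shows "pm_filter D p \<in> U"
proof -
  have "pm_filter D (0 :: 'a \<Rightarrow>\<^sub>0 'b) = 0" "pm_filter D (p + q) = pm_filter D p + pm_filter D q"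
    "pm_filter D (pm_scale c p) = pm_scale c (pm_filter D p)" for p q :: "'a \<Rightarrow>\<^sub>0 'b" and c
    by (auto intro!: poly_mapping_eqI simp: lookup_add)
  then have "pm.subspace {p. pm_filter D p \<in> U}"
    using U by (intro pm.subspaceI) (auto simp: pm.subspace_def)
  then show ?thesis using pm.span_subspace_induct[OF p] S by blast
qed

section \<open>Ideals of polynomial rings as subspaces\<close>

lemma mpoly_ring_simps [simp]:
  "mult (mpoly_ring X) = (*)" "one (mpoly_ring X) = 1" "zero (mpoly_ring X) = 0"
  "add (mpoly_ring X) = (+)"
  by (simp_all add: mpoly_ring_def)

lemma carrier_mpoly_ring:
  "p \<in> carrier (mpoly_ring X) \<longleftrightarrow> (\<forall>m\<in>keys p. keys m \<subseteq> X)"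
  by (simp add: mpoly_ring_def)

lemma a_inv_mpoly_ring:
  assumes "p \<in> carrier (mpoly_ring X)"
  shows "\<ominus>\<^bsub>mpoly_ring X\<^esub> p = - p"
proof -
  interpret cring "mpoly_ring X :: ('a, 'b) mpoly ring" by (rule cring_mpoly_ring)
  have "- p \<in> carrier (mpoly_ring X)"
    using assms by (simp add: carrier_mpoly_ring in_keys_iff)
  then show ?thesis using minus_equality[of "- p" p] assms by simp
qed

lemma subspace_carrier: "pm.subspace (carrier (mpoly_ring X :: ('i, 'k::field) mpoly ring))"
  using keys_add by (fastforce intro!: pm.subspaceI simp: carrier_mpoly_ring in_keys_iff lookup_add)

lemma carrier_mult:
  "p \<in> carrier (mpoly_ring X) \<Longrightarrow> q \<in> carrier (mpoly_ring X) \<Longrightarrow> p * q \<in> carrier (mpoly_ring X)"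
  for p :: "('i, 'k::field) mpoly"
  using ring.ring_simprules(5)[OF cring.axioms(1)[OF cring_mpoly_ring[of X]], of p q] by simp

lemma ideal_mpolyI:
  assumes sub: "pm.subspace I" "I \<subseteq> carrier (mpoly_ring X)"
    and mult: "\<And>m p. keys m \<subseteq> X \<Longrightarrow> p \<in> I \<Longrightarrow> single m 1 * p \<in> I"
  shows "ideal I (mpoly_ring X :: ('i, 'k::field) mpoly ring)"
proof -
  let ?R = "mpoly_ring X :: ('i, 'k::field) mpoly ring"
  interpret cring ?R by (rule cring_mpoly_ring)
  have *: "q * p \<in> I" if "q \<in> carrier ?R" "p \<in> I" for p q
  proof -
    have "q * p = (\<Sum>m\<in>keys q. pm_scale (lookup q m) (single m 1 * p))"
      by (subst mpoly_expand[of q]) 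
        (simp add: sum_distrib_right pm_scale_mult_left[symmetric])
    also have "\<dots> \<in> I"
      using that mult by (intro pm.subspace_sum[OF sub(1)] pm.subspace_scale[OF sub(1)])
        (auto simp: carrier_mpoly_ring)
    finally show ?thesis .
  qed
  show ?thesis
  proof (rule idealI)
    show "subgroup I (add_monoid ?R)"
    proof (rule add.subgroupI)
      show "I \<noteq> {}" using pm.subspace_0[OF sub(1)] by auto
      fix a assume a: "a \<in> I"
      then have "\<ominus>\<^bsub>?R\<^esub> a = - a" using sub(2) by (intro a_inv_mpoly_ring) auto
      then show "\<ominus>\<^bsub>?R\<^esub> a \<in> I" using pm.subspace_neg[OF sub(1) a] by simp
    qed (use sub pm.subspace_add[OF sub(1)] in auto)
    fix a x assume "a \<in> I" "x \<in> carrier ?R"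
    then have "x * a \<in> I" by (intro *)
    then show "x \<otimes>\<^bsub>?R\<^esub> a \<in> I" "a \<otimes>\<^bsub>?R\<^esub> x \<in> I" by (simp_all add: mult.commute[of a])
  qed (rule ring_axioms)
qed

lemma ideal_mpolyD:
  assumes "ideal I (mpoly_ring X :: ('i, 'k::field) mpoly ring)"
  shows "pm.subspace I" "I \<subseteq> carrier (mpoly_ring X)"
    "\<And>p q. p \<in> carrier (mpoly_ring X) \<Longrightarrow> q \<in> I \<Longrightarrow> p * q \<in> I"
proof -
  interpret ideal I "mpoly_ring X :: ('i, 'k) mpoly ring" by fact
  show "I \<subseteq> carrier (mpoly_ring X)" by (rule a_subset)
  show *: "\<And>p q. p \<in> carrier (mpoly_ring X) \<Longrightarrow> q \<in> I \<Longrightarrow> p * q \<in> I"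
    using I_l_closed by simp
  show "pm.subspace I"
  proof (rule pm.subspaceI)
    show "0 \<in> I" using additive_subgroup.zero_closed[OF additive_subgroup_axioms] by simp
    show "x + y \<in> I" if "x \<in> I" "y \<in> I" for x y using additive_subgroup.a_closed[OF additive_subgroup_axioms that] by simp
    show "pm_scale c x \<in> I" if "x \<in> I" for c x
      using *[of "mconst c" x] that by (simp add: carrier_mpoly_ring mconst_mult) (simp add: mconst_def)
  qed
qed

definition monomial_multiples :: "'i set \<Rightarrow> ('i, 'k::field) mpoly set \<Rightarrow> ('i, 'k) mpoly set" where
  "monomial_multiples X S = {single m 1 * s | m s. keys m \<subseteq> X \<and> s \<in> S}"

text \<open>
  Turns statements about generated ideals into linear algebra over the field.
\<close>
lemma genideal_eq_span:
  fixes S :: "('i, 'k::field) mpoly set"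
  assumes S: "S \<subseteq> carrier (mpoly_ring X)"
  shows "Idl\<^bsub>mpoly_ring X\<^esub> S = pm.span (monomial_multiples X S)"
proof
  let ?R = "mpoly_ring X :: ('i, 'k::field) mpoly ring"
  interpret cring ?R by (rule cring_mpoly_ring)
  have sub: "S \<subseteq> monomial_multiples X S"
  proof
    fix s assume "s \<in> S"
    then have "single 0 1 * s \<in> monomial_multiples X S"
      unfolding monomial_multiples_def by (intro CollectI exI[of _ 0] exI[of _ s]) simp
    then show "s \<in> monomial_multiples X S" by simp
  qed
  have car: "single m 1 \<in> carrier ?R" if "keys m \<subseteq> X" for m :: "'i \<Rightarrow>\<^sub>0 nat"
    using that by (simp add: carrier_mpoly_ring)
  have mm: "monomial_multiples X S \<subseteq> carrier ?R"
    using S by (auto simp: monomial_multiples_def intro!: carrier_mult car)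
  have "ideal (pm.span (monomial_multiples X S)) ?R"
  proof (rule ideal_mpolyI)
    show "pm.span (monomial_multiples X S) \<subseteq> carrier ?R"
      using mm subspace_carrier by (rule pm.span_minimal)
    fix m :: "'i \<Rightarrow>\<^sub>0 nat" and p assume m: "keys m \<subseteq> X" and p: "p \<in> pm.span (monomial_multiples X S)"
    have "pm.subspace {p. single m 1 * p \<in> pm.span (monomial_multiples X S)}"
      by (rule pm.subspaceI)
        (auto simp: distrib_left pm_scale_mult_right intro: pm.span_zero pm.span_add pm.span_scale)
    moreover have "single m 1 * q \<in> pm.span (monomial_multiples X S)"
      if q: "q \<in> monomial_multiples X S" for q
    proof -
      obtain n s where q: "q = single n 1 * s" "keys n \<subseteq> X" "s \<in> S"
        using q by (auto simp: monomial_multiples_def)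
      have "single m 1 * q = single (m + n) 1 * s"
        unfolding q mult.assoc[symmetric] by (simp add: mult_single)
      moreover have "keys (m + n) \<subseteq> X" using keys_add[of m n] m q by auto
      ultimately show ?thesis
        using q by (intro pm.span_base) (auto simp: monomial_multiples_def)
    qed
    ultimately show "single m 1 * p \<in> pm.span (monomial_multiples X S)"
      using pm.span_subspace_induct[OF p] by blast
  qed simp
  then show "Idl\<^bsub>?R\<^esub> S \<subseteq> pm.span (monomial_multiples X S)"
    by (rule genideal_minimal) (rule order_trans[OF sub pm.span_superset])
  show "pm.span (monomial_multiples X S) \<subseteq> Idl\<^bsub>?R\<^esub> S"
  proof -
    note gen = ideal_mpolyD[OF genideal_ideal[OF S]]
    have "single m 1 * s \<in> Idl\<^bsub>?R\<^esub> S" if "keys m \<subseteq> X" "s \<in> S" for m s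
      using car[OF that(1)] genideal_self[OF S] that(2) by (intro gen(3)) auto
    then show ?thesis
      by (intro pm.span_minimal gen(1)) (auto simp: monomial_multiples_def)
  qed
qed

section \<open>Vertex degrees of monomials and the toric ideal\<close>

definition vdeg :: "('a set \<Rightarrow>\<^sub>0 nat) \<Rightarrow> 'a \<Rightarrow> nat" where
  "vdeg m v = wsum (\<lambda>e. if v \<in> e then 1 else 0) m"

lemma vdeg_zero [simp]: "vdeg 0 v = 0" by (simp add: vdeg_def)

lemma vdeg_add: "vdeg (m + n) v = vdeg m v + vdeg n v"
  by (simp add: vdeg_def wsum_add)

lemma vdeg_add_left_cancel: "vdeg (m + a) = vdeg (m + b) \<longleftrightarrow> vdeg a = vdeg b"
  by (auto simp: fun_eq_iff vdeg_add)

lemma vdeg_single: "vdeg (single e n) v = (if v \<in> e then n else 0)"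
  by (simp add: vdeg_def)

lemma vdeg_eq_0_iff: "vdeg m v = 0 \<longleftrightarrow> (\<forall>e\<in>keys m. v \<notin> e)"
  by (auto simp: vdeg_def wsum_def in_keys_iff)

lemma single_power: "single m (1::'k::field) ^ n = single (\<Sum>i<n. m) 1" for m :: "'i \<Rightarrow>\<^sub>0 nat"
  by (induction n) (simp_all add: mult_single add.commute)

lemma prod_single: "(\<Prod>i\<in>A. single (g i) (1::'k::field)) = single (\<Sum>i\<in>A. g i) 1"
  for g :: "'n \<Rightarrow> 'i \<Rightarrow>\<^sub>0 nat"
  by (induction A rule: infinite_finite_induct) (simp_all add: mult_single)

text \<open>
  The exponent of the image of a monomial under the substitution of \<open>\<Prod>v\<in>e. mvar (\<iota> v)\<close> for the
  variable \<open>e\<close>. The renaming \<open>\<iota>\<close> of the vertices allows a passage to natural numbers as variables.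
\<close>
definition edge_monomial :: "('a \<Rightarrow> 'b) \<Rightarrow> ('a set \<Rightarrow>\<^sub>0 nat) \<Rightarrow> 'b \<Rightarrow>\<^sub>0 nat" where
  "edge_monomial \<iota> m = (\<Sum>e\<in>keys m. \<Sum>i<lookup m e. \<Sum>v\<in>e. single (\<iota> v) 1)"

lemma subst_edge_monomial:
  "mpoly_subst (\<lambda>e. \<Prod>v\<in>e. mvar (\<iota> v)) p = (\<Sum>m\<in>keys p. single (edge_monomial \<iota> m) (lookup p m))"
  by (simp add: mpoly_subst_def mvar_def prod_single single_power edge_monomial_def mconst_mult)

lemma lookup_edge_monomial:
  assumes inj: "inj_on \<iota> V" and m: "\<And>e. e \<in> keys m \<Longrightarrow> finite e \<and> e \<subseteq> V" and v: "v \<in> V"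
  shows "lookup (edge_monomial \<iota> m) (\<iota> v) = vdeg m v"
proof -
  have "(\<Sum>u\<in>e. lookup (single (\<iota> u) 1) (\<iota> v)) = (if v \<in> e then 1 else (0::nat))"
    if "e \<in> keys m" for e
  proof -
    have "(\<Sum>u\<in>e. lookup (single (\<iota> u) 1) (\<iota> v)) = (\<Sum>u\<in>e. if u = v then 1 else (0::nat))"
      using m[OF that] v inj by (intro sum.cong) (auto simp: lookup_single when_def inj_on_def)
    then show ?thesis using m[OF that] by simp
  qed
  then show ?thesis
    by (simp add: edge_monomial_def lookup_sum vdeg_def wsum_def)
qed

lemma edge_monomial_eq_iff:
  assumes inj: "inj_on \<iota> V" and m: "\<And>e. e \<in> keys m \<Longrightarrow> finite e \<and> e \<subseteq> V"
    and n: "\<And>e. e \<in> keys n \<Longrightarrow> finite e \<and> e \<subseteq> V"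
  shows "edge_monomial \<iota> m = edge_monomial \<iota> n \<longleftrightarrow> vdeg m = vdeg n"
proof
  assume eq: "edge_monomial \<iota> m = edge_monomial \<iota> n"
  show "vdeg m = vdeg n"
  proof
    fix v
    show "vdeg m v = vdeg n v"
    proof (cases "v \<in> V")
      case True
      then show ?thesis using lookup_edge_monomial[OF inj] m n eq by metis
    next
      case False
      then have "vdeg m v = 0" "vdeg n v = 0" using m n by (auto simp: vdeg_eq_0_iff)
      then show ?thesis by simp
    qed
  qed
next
  assume eq: "vdeg m = vdeg n"
  show "edge_monomial \<iota> m = edge_monomial \<iota> n"
  proof (rule poly_mapping_eqI)
    fix w
    show "lookup (edge_monomial \<iota> m) w = lookup (edge_monomial \<iota> n) w"
    proof (cases "w \<in> \<iota> ` V")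
      case True
      then show ?thesis using lookup_edge_monomial[OF inj] m n eq by auto
    next
      case False
      have "lookup (edge_monomial \<iota> l) w = 0" if "\<And>e. e \<in> keys l \<Longrightarrow> finite e \<and> e \<subseteq> V" for l
        using that False unfolding edge_monomial_def lookup_sum
        by (intro sum.neutral ballI) (auto simp: lookup_single when_def)
      then show ?thesis using m n by metis
    qed
  qed
qed

text \<open>
  The toric ideal in terms of coefficients: a polynomial is mapped to \<open>0\<close> if and only if the
  coefficients of those of its monomials that have the same image sum up to \<open>0\<close>.
\<close>
definition toric_set :: "'a set set \<Rightarrow> ('a set, 'k::field) mpoly set" where
  "toric_set E = {p \<in> carrier (mpoly_ring E). \<forall>d. wsum (\<lambda>m. if vdeg m = d then 1 else 0) p = 0}"

lemma subst_zero_iff: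
  assumes inj: "inj_on \<iota> V" and E: "\<And>e. e \<in> E \<Longrightarrow> finite e \<and> e \<subseteq> V"
    and p: "p \<in> carrier (mpoly_ring E)"
  shows "mpoly_subst (\<lambda>e. \<Prod>v\<in>e. mvar (\<iota> v)) p = 0 \<longleftrightarrow>
    (\<forall>d. wsum (\<lambda>m. if vdeg m = d then 1 else 0) p = 0)"
proof -
  let ?q = "mpoly_subst (\<lambda>e. \<Prod>v\<in>e. mvar (\<iota> v)) p"
  let ?w = "\<lambda>d. wsum (\<lambda>m. if vdeg m = d then 1 else 0) p"
  have pE: "finite e \<and> e \<subseteq> V" if "m \<in> keys p" "e \<in> keys m" for m e
    using p E that by (auto simp: carrier_mpoly_ring)
  have lk: "lookup ?q d = (\<Sum>m\<in>keys p. if edge_monomial \<iota> m = d then lookup p m else 0)" for d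
    by (simp add: subst_edge_monomial lookup_sum lookup_single when_def)
  have eq: "lookup ?q (edge_monomial \<iota> n) = ?w (vdeg n)" if "n \<in> keys p" for n
    unfolding lk wsum_def using edge_monomial_eq_iff[OF inj] pE that by (intro sum.cong) auto
  show ?thesis
  proof
    assume 0: "?q = 0"
    show "\<forall>d. ?w d = 0"
    proof
      fix d
      show "?w d = 0"
      proof (cases "\<exists>n\<in>keys p. vdeg n = d")
        case True
        then show ?thesis using eq 0 by force
      next
        case False
        then show ?thesis unfolding wsum_def by (intro sum.neutral) auto
      qed
    qed
  next
    assume 0: "\<forall>d. ?w d = 0"
    show "?q = 0"
    proof (rule poly_mapping_eqI)
      fix d
      show "lookup ?q d = lookup 0 d"
      proof (cases "\<exists>n\<in>keys p. edge_monomial \<iota> n = d")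
        case True
        then show ?thesis using eq 0 by force
      next
        case False
        then show ?thesis unfolding lk by (auto intro!: sum.neutral)
      qed
    qed
  qed
qed

lemma simple_graph_edge:
  assumes "simple_graph V E" "e \<in> E"
  shows "finite e" "e \<subseteq> V" "card e = 2"
  using assms by (auto simp: simple_graph_def)

lemma toric_ideal_eq:
  assumes "simple_graph V E"
  shows "toric_ideal V E = toric_set E"
  using subst_zero_iff[of "\<lambda>v. v" V E] simple_graph_edge[OF assms]
  by (fastforce simp: toric_ideal_def a_kernel_def' toric_map_def toric_set_def inj_on_def)

lemma subspace_toric_set: "pm.subspace (toric_set E :: ('a set, 'k::field) mpoly set)"
proof -
  have "pm.subspace (\<Inter>d. {p :: ('a set, 'k) mpoly. wsum (\<lambda>m. if vdeg m = d then 1 else 0) p = 0})"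
    using subspace_wsum by (intro pm.subspace_Int) blast
  then have "pm.subspace (carrier (mpoly_ring E) \<inter> 
    (\<Inter>d. {p :: ('a set, 'k) mpoly. wsum (\<lambda>m. if vdeg m = d then 1 else 0) p = 0}))"
    by (rule pm.subspace_inter[OF subspace_carrier])
  then show ?thesis by (simp add: toric_set_def Int_def)
qed

text \<open>
  The ideal is the kernel of a homomorphism into a polynomial ring over a field. Absence of zero
  divisors is known for linearly ordered variables, hence the vertices are renamed to natural numbers.
\<close>
lemma primeideal_toric_set:
  assumes "simple_graph V E"
  shows "primeideal (toric_set E :: ('a set, 'k::field) mpoly set) (mpoly_ring E)"
proof -
  let ?R = "mpoly_ring E :: ('a set, 'k) mpoly ring"
  interpret R: cring ?R by (rule cring_mpoly_ring)
  obtain \<iota> :: "'a \<Rightarrow> nat" where inj: "inj_on \<iota> V"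
    using assms finite_imp_inj_to_nat_seg[of V] by (auto simp: simple_graph_def)
  let ?f = "mpoly_subst (\<lambda>e. \<Prod>v\<in>e. mvar (\<iota> v)) :: ('a set, 'k) mpoly \<Rightarrow> (nat, 'k) mpoly"
  have iff: "p \<in> toric_set E \<longleftrightarrow> ?f p = 0" if "p \<in> carrier ?R" for p
    using subst_zero_iff[OF inj _ that] simple_graph_edge[OF assms] that by (simp add: toric_set_def)
  have car: "toric_set E \<subseteq> carrier ?R" by (auto simp: toric_set_def)
  have 1: "?f 1 = 1" using mpoly_subst_const[of _ 1] by (simp add: mconst_def)
  have mult: "single m 1 * p \<in> toric_set E" if "keys m \<subseteq> E" "p \<in> toric_set E"
    for m and p :: "('a set, 'k) mpoly"
  proof -
    have "single m 1 * p \<in> carrier ?R"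
      using that car by (intro carrier_mult) (auto simp: carrier_mpoly_ring[of "single _ _"])
    then show ?thesis
      using that car iff[of p] iff[of "single m 1 * p"] by (auto simp: mpoly_subst_mult)
  qed
  have "ideal (toric_set E) ?R"
    by (rule ideal_mpolyI[OF subspace_toric_set car mult])
  then show ?thesis
  proof (rule primeidealI)
    show "cring ?R" by (rule cring_mpoly_ring)
    have "1 \<in> carrier ?R" by (simp add: carrier_mpoly_ring)
    moreover from iff[OF this] have "1 \<notin> (toric_set E :: ('a set, 'k) mpoly set)"
      using 1 by simp
    ultimately show "carrier ?R \<noteq> toric_set E" by blast
    fix a b assume ab: "a \<in> carrier ?R" "b \<in> carrier ?R" "a \<otimes>\<^bsub>?R\<^esub> b \<in> toric_set E"
    then have "?f a * ?f b = 0"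
      using iff[of "a * b"] carrier_mult[OF ab(1,2)] by (simp add: mpoly_subst_mult)
    then show "a \<in> toric_set E \<or> b \<in> toric_set E" using iff ab by auto
  qed
qed

definition binomials :: "'a set set \<Rightarrow> ('a set, 'k::field) mpoly set" where
  "binomials E = {single a 1 - single b 1 | a b. keys a \<subseteq> E \<and> keys b \<subseteq> E \<and> vdeg a = vdeg b}"

text \<open>
  Choose a representative in each class of monomials of equal vertex degrees. Replacing every monomial
  of a polynomial by its representative changes it by a combination of binomials and, if the
  polynomial is in the toric ideal, cancels everything.
\<close>
lemma toric_set_eq_span: "toric_set E = pm.span (binomials E :: ('a set, 'k::field) mpoly set)"
proof
  have "single a 1 - single b (1::'k) \<in> toric_set E"
    if "keys a \<subseteq> E" "keys b \<subseteq> E" "vdeg a = vdeg b" for a b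
    using that pm.subspace_diff[OF subspace_carrier[where 'k='k], of "single a 1" E "single b 1"]
    by (auto simp: toric_set_def wsum_diff carrier_mpoly_ring[of "single _ _"])
  then show "pm.span (binomials E) \<subseteq> (toric_set E :: ('a set, 'k) mpoly set)"
    by (intro pm.span_minimal subspace_toric_set) (auto simp: binomials_def)
  show "(toric_set E :: ('a set, 'k) mpoly set) \<subseteq> pm.span (binomials E)"
  proof
    fix p :: "('a set, 'k) mpoly" assume p: "p \<in> toric_set E"
    define rep where "rep d = (SOME m :: 'a set \<Rightarrow>\<^sub>0 nat. keys m \<subseteq> E \<and> vdeg m = d)" for d
    have rep: "keys (rep (vdeg m)) \<subseteq> E" "vdeg (rep (vdeg m)) = vdeg m" if "m \<in> keys p" for m
      using p that someI[of "\<lambda>n. keys n \<subseteq> E \<and> vdeg n = vdeg m" m]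
      by (auto simp: rep_def toric_set_def carrier_mpoly_ring)
    have z: "(\<Sum>m\<in>keys p. single (rep (vdeg m)) (lookup p m)) = 0"
    proof (rule poly_mapping_eqI)
      fix n
      have "lookup (\<Sum>m\<in>keys p. single (rep (vdeg m)) (lookup p m)) n =
          (\<Sum>m\<in>keys p. if rep (vdeg m) = n then lookup p m else 0)"
        by (simp add: lookup_sum lookup_single when_def)
      also have "\<dots> = 0"
      proof (cases "\<exists>m\<in>keys p. rep (vdeg m) = n")
        case True
        then obtain m0 where m0: "m0 \<in> keys p" "rep (vdeg m0) = n" by blast
        have "(\<Sum>m\<in>keys p. if rep (vdeg m) = n then lookup p m else 0) =
            wsum (\<lambda>m. if vdeg m = vdeg m0 then 1 else 0) p"
          unfolding wsum_def using rep m0 by (intro sum.cong) (auto, metis)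
        then show ?thesis using p by (simp add: toric_set_def)
      next
        case False
        then show ?thesis by (intro sum.neutral) auto
      qed
      finally show "lookup (\<Sum>m\<in>keys p. single (rep (vdeg m)) (lookup p m)) n = lookup 0 n" by simp
    qed
    have "p = (\<Sum>m\<in>keys p. single m (lookup p m)) - (\<Sum>m\<in>keys p. single (rep (vdeg m)) (lookup p m))"
      unfolding z using mpoly_expand by simp
    also have "\<dots> = (\<Sum>m\<in>keys p. pm_scale (lookup p m) (single m 1 - single (rep (vdeg m)) 1))"
      by (simp add: sum_subtractf pm.scale_right_diff_distrib)
    also have "\<dots> \<in> pm.span (binomials E)"
      using p rep by (intro pm.span_sum pm.span_scale pm.span_base)
        (force simp: binomials_def toric_set_def carrier_mpoly_ring)
    finally show "p \<in> pm.span (binomials E)" .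
  qed
qed

section \<open>An upper bound for the height\<close>

text \<open>
  The bounds on the dimension of residue rings come from counting. Bounding each exponent separately,
  rather than the total degree, makes these counts powers.
\<close>
definition box :: "'i set \<Rightarrow> nat \<Rightarrow> ('i, 'k::field) mpoly set" where
  "box X t = {p. \<forall>m\<in>keys p. keys m \<subseteq> X \<and> (\<forall>i. lookup m i \<le> t)}"

lemma box_mult:
  assumes "p \<in> box X s" "q \<in> box X t"
  shows "p * q \<in> box X (s + t)"
proof -
  have "keys m \<subseteq> X \<and> (\<forall>i. lookup m i \<le> s + t)" if m: "m \<in> keys (p * q)" for m
  proof -
    obtain a b where ab: "m = a + b" "a \<in> keys p" "b \<in> keys q"
      using keys_mult[of p q] m by auto
    then have "keys a \<subseteq> X" "keys b \<subseteq> X" "\<And>i. lookup a i \<le> s" "\<And>i. lookup b i \<le> t"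
      using assms by (auto simp: box_def)
    then show ?thesis using keys_add[of a b] ab(1) by (auto simp: lookup_add intro: add_mono)
  qed
  then show ?thesis by (auto simp: box_def)
qed

lemma box_mono: "s \<le> t \<Longrightarrow> box X s \<subseteq> box X t"
  by (auto simp: box_def intro: order_trans[of _ s t])

lemma box_power: "p \<in> box X s \<Longrightarrow> p ^ j \<in> box X (j * s)"
proof (induction j)
  case 0
  then show ?case by (auto simp: box_def)
next
  case (Suc j)
  then show ?case using box_mult[of p X s "p ^ j" "j * s"] by simp
qed

lemma box_subset_carrier: "box X t \<subseteq> carrier (mpoly_ring X)"
  by (auto simp: box_def carrier_mpoly_ring)

lemma ex_box:
  assumes "p \<in> carrier (mpoly_ring X)"
  shows "\<exists>d. p \<in> box X d"
proof -
  let ?B = "\<Union>m\<in>keys p. lookup m ` keys m"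
  have "finite ?B" by simp
  then obtain d where d: "\<forall>x\<in>?B. x \<le> d" using finite_nat_set_iff_bounded_le by blast
  have "lookup m i \<le> d" if "m \<in> keys p" for m i
    using d that by (cases "i \<in> keys m") (auto simp: in_keys_iff)
  then show ?thesis using assms by (auto simp: box_def carrier_mpoly_ring)
qed

definition exponent_box :: "'i set \<Rightarrow> nat \<Rightarrow> ('i \<Rightarrow>\<^sub>0 nat) set" where
  "exponent_box X t = {m. keys m \<subseteq> X \<and> (\<forall>i. lookup m i \<le> t)}"

lemma card_exponent_box:
  assumes "finite X"
  shows "finite (exponent_box X t)" "card (exponent_box X t) = (t + 1) ^ card X"
proof -
  let ?F = "X \<rightarrow>\<^sub>E {..t}"
  have bij: "bij_betw (\<lambda>m. restrict (lookup m) X) (exponent_box X t) ?F"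
  proof (rule bij_betwI')
    fix f assume f: "f \<in> ?F"
    let ?g = "\<lambda>x. if x \<in> X then f x else 0"
    have "{x. ?g x \<noteq> 0} \<subseteq> X" by auto
    then have "finite {x. ?g x \<noteq> 0}" using assms by (rule finite_subset)
    then have g: "lookup (Abs_poly_mapping ?g) = ?g" by simp
    have "f = restrict (lookup (Abs_poly_mapping ?g)) X"
      unfolding g using f by (auto simp: restrict_def PiE_def extensional_def)
    moreover have "keys (Abs_poly_mapping ?g) \<subseteq> X"
      by (auto simp: in_keys_iff g split: if_splits)
    moreover have "lookup (Abs_poly_mapping ?g) i \<le> t" for i
      unfolding g using f by auto
    ultimately show "\<exists>m\<in>exponent_box X t. f = restrict (lookup m) X"
      by (intro bexI[of _ "Abs_poly_mapping ?g"]) (auto simp: exponent_box_def)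
  next
    fix m n assume mn: "m \<in> exponent_box X t" "n \<in> exponent_box X t"
    show "restrict (lookup m) X = restrict (lookup n) X \<longleftrightarrow> m = n"
    proof
      assume eq: "restrict (lookup m) X = restrict (lookup n) X"
      show "m = n"
      proof (rule poly_mapping_eqI)
        fix x
        have "x \<notin> keys m \<and> x \<notin> keys n" if "x \<notin> X"
          using mn that by (auto simp: exponent_box_def)
        then show "lookup m x = lookup n x"
          using fun_cong[OF eq, of x] by (cases "x \<in> X") (auto simp: in_keys_iff)
      qed
    qed simp
  qed (auto simp: exponent_box_def)
  have "finite ?F" "card ?F = (t + 1) ^ card X"
    using assms by (simp_all add: finite_PiE card_PiE)
  then show "finite (exponent_box X t)" "card (exponent_box X t) = (t + 1) ^ card X"
    using bij_betw_finite[OF bij] bij_betw_same_card[OF bij] by simp_all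
qed

definition indep_mod :: "('i, 'k::field) mpoly set \<Rightarrow> 'n set \<Rightarrow> ('n \<Rightarrow> ('i, 'k) mpoly) \<Rightarrow> bool" where
  "indep_mod P I g \<longleftrightarrow> (\<forall>c. (\<Sum>i\<in>I. pm_scale (c i) (g i)) \<in> P \<longrightarrow> (\<forall>i\<in>I. c i = 0))"

text \<open>
  A lower bound for the Hilbert function of the residue ring modulo \<open>P\<close>: at least \<open>N\<close> polynomials with
  exponents at most \<open>t\<close> are linearly independent modulo \<open>P\<close>.
\<close>
definition indep_family :: "'i set \<Rightarrow> ('i, 'k::field) mpoly set \<Rightarrow> nat \<Rightarrow> nat \<Rightarrow> bool" where
  "indep_family X P t N \<longleftrightarrow> (\<exists>g. (\<forall>i<N. g i \<in> box X t) \<and> indep_mod P {..<N} g)"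

lemma indep_familyI:
  assumes I: "finite I" and g: "\<And>i. i \<in> I \<Longrightarrow> g i \<in> box X t" and ind: "indep_mod P I g"
  shows "indep_family X P t (card I)"
proof -
  obtain h where h: "bij_betw h {..<card I} I"
    using ex_bij_betw_nat_finite[OF I] by (auto simp: atLeast0LessThan)
  have "indep_mod P {..<card I} (g \<circ> h)"
    unfolding indep_mod_def
  proof (intro allI impI ballI)
    fix c i assume c: "(\<Sum>i<card I. pm_scale (c i) ((g \<circ> h) i)) \<in> P" and i: "i \<in> {..<card I}"
    let ?h' = "the_inv_into {..<card I} h"
    have inv: "?h' (h j) = j" if "j < card I" for j
      using that h by (auto intro: the_inv_into_f_f simp: bij_betw_def)
    have "(\<Sum>i\<in>I. pm_scale (c (?h' i)) (g i)) = (\<Sum>i<card I. pm_scale (c i) ((g \<circ> h) i))"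
      by (subst sum.reindex_bij_betw[OF h, symmetric]) (auto simp: inv)
    then have "(\<Sum>i\<in>I. pm_scale (c (?h' i)) (g i)) \<in> P" using c by simp
    then have "\<forall>j\<in>I. c (?h' j) = 0"
      using ind[unfolded indep_mod_def] by (elim allE[of _ "\<lambda>i. c (?h' i)"] impE)
    then have "c (?h' (h i)) = 0" using i bij_betwE[OF h] by auto
    then show "c i = 0" using inv i by simp
  qed
  then show ?thesis
    using g bij_betwE[OF h] unfolding indep_family_def by (intro exI[of _ "g \<circ> h"]) auto
qed

lemma indep_family_le:
  fixes P :: "('i, 'k::field) mpoly set"
  assumes "finite X" "indep_family X P t N" "0 \<in> P"
  shows "N \<le> (t + 1) ^ card X"
proof -
  obtain g where g: "\<And>i. i < N \<Longrightarrow> g i \<in> box X t" "indep_mod P {..<N} g"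
    using assms(2) by (auto simp: indep_family_def)
  \<comment> \<open>The ideal contains \<open>0\<close>, so independence modulo it implies linear independence.\<close>
  have z: "c i = 0" if "(\<Sum>i<N. pm_scale (c i) (g i)) = 0" "i \<in> {..<N}" for c i
    using g(2) assms(3) that unfolding indep_mod_def by (metis (no_types, lifting))
  have *: "inj_on g {..<N}" "pm.independent (g ` {..<N})"
    by (rule independent_image_if_scalars_zero[of "{..<N}" g]; use z in blast)+
  let ?M = "(\<lambda>m. single m (1::'k)) ` exponent_box X t"
  have "g ` {..<N} \<subseteq> pm.span ?M"
  proof clarsimp
    fix i assume i: "i < N"
    have "(\<Sum>m\<in>keys (g i). pm_scale (lookup (g i) m) (single m 1)) \<in> pm.span ?M"
      using g(1)[OF i]
      by (intro pm.span_sum pm.span_scale pm.span_base) (auto simp: box_def exponent_box_def)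
    then show "g i \<in> pm.span ?M" by (subst mpoly_expand) simp
  qed
  then have "card (g ` {..<N}) \<le> card ?M"
    using pm.independent_span_bound[OF _ *(2)] card_exponent_box(1)[OF assms(1)] by blast
  also have "\<dots> \<le> (t + 1) ^ card X"
    using card_image_le[OF card_exponent_box(1)[OF assms(1)], of "\<lambda>m. single m (1::'k)" t] 
    by (simp only: card_exponent_box(2)[OF assms(1)])
  finally show ?thesis by (simp add: card_image[OF *(1)])
qed

text \<open>
  Let \<open>f\<close> be in \<open>Q\<close> but not in \<open>P\<close>. A relation modulo \<open>P\<close> between the \<open>f ^ j * g i\<close>, read modulo \<open>Q\<close>,
  involves only the terms with \<open>j = 0\<close>, so their coefficients vanish. The remaining relation can be
  divided by \<open>f\<close>, because \<open>P\<close> is prime, and induction applies.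
\<close>
lemma indep_mod_powers:
  fixes P Q :: "('i, 'k::field) mpoly set"
  assumes P: "primeideal P (mpoly_ring X)" and Q: "primeideal Q (mpoly_ring X)"
    and PQ: "P \<subseteq> Q" and f: "f \<in> Q" "f \<notin> P"
    and I: "finite I" and g: "\<And>i. i \<in> I \<Longrightarrow> g i \<in> carrier (mpoly_ring X)" and ind: "indep_mod Q I g"
  shows "indep_mod P (I \<times> {..J}) (\<lambda>(i, j). f ^ j * g i)"
proof -
  let ?R = "mpoly_ring X :: ('i, 'k) mpoly ring"
  note Pi = ideal_mpolyD[OF primeideal.axioms(1)[OF P]]
  note Qi = ideal_mpolyD[OF primeideal.axioms(1)[OF Q]]
  have fc: "f \<in> carrier ?R" using f(1) Qi(2) by auto
  have pc: "f ^ j \<in> carrier ?R" for j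
    by (induction j) (auto intro: carrier_mult fc simp: carrier_mpoly_ring[of 1])
  have sc: "sum h A \<in> carrier ?R" if "\<And>x. x \<in> A \<Longrightarrow> h x \<in> carrier ?R" for h and A :: "'n set"
    using that by (rule pm.subspace_sum[OF subspace_carrier])
  have main: "\<forall>i\<in>I. \<forall>j\<le>J. c i j = 0"
    if "(\<Sum>j\<le>J. f ^ j * (\<Sum>i\<in>I. pm_scale (c i j) (g i))) \<in> P" for c
    using that
  proof (induction J arbitrary: c)
    case 0
    then have "(\<Sum>i\<in>I. pm_scale (c i 0) (g i)) \<in> Q" using PQ by auto
    then show ?case using ind by (auto simp: indep_mod_def)
  next
    case (Suc J)
    let ?G = "\<lambda>j. \<Sum>i\<in>I. pm_scale (c i j) (g i)"
    let ?h = "\<Sum>j\<le>J. f ^ j * ?G (Suc j)"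
    have Gc: "?G j \<in> carrier ?R" for j
      using g by (intro sc pm.subspace_scale[OF subspace_carrier]) auto
    have hc: "?h \<in> carrier ?R"
      by (intro pm.subspace_sum[OF subspace_carrier] carrier_mult pc Gc)
    have eq: "(\<Sum>j\<le>Suc J. f ^ j * ?G j) = ?G 0 + f * ?h"
      by (subst sum.atMost_Suc_shift) (simp add: sum_distrib_left mult.assoc)
    have "f * ?h \<in> Q" using Qi(3)[OF hc f(1)] by (simp add: mult.commute)
    moreover have "?G 0 + f * ?h \<in> Q" using Suc.prems PQ unfolding eq by auto
    ultimately have "?G 0 + f * ?h - f * ?h \<in> Q" by (rule pm.subspace_diff[OF Qi(1), rotated])
    then have 0: "\<forall>i\<in>I. c i 0 = 0" using ind by (auto simp: indep_mod_def)
    then have "?G 0 = 0" by simp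
    then have "f * ?h \<in> P" using Suc.prems unfolding eq by simp
    then have "?h \<in> P" using primeideal.I_prime[OF P fc hc] f(2) by auto
    from Suc.IH[OF this] have "\<forall>i\<in>I. \<forall>j\<le>J. c i (Suc j) = 0" .
    with 0 show ?case by (metis Suc_le_mono not0_implies_Suc)
  qed
  show ?thesis
    unfolding indep_mod_def
  proof (intro allI impI)
    fix c assume "(\<Sum>x\<in>I \<times> {..J}. pm_scale (c x) ((\<lambda>(i, j). f ^ j * g i) x)) \<in> P"
    also have "(\<Sum>x\<in>I \<times> {..J}. pm_scale (c x) ((\<lambda>(i, j). f ^ j * g i) x)) =
      (\<Sum>i\<in>I. \<Sum>j\<le>J. f ^ j * pm_scale (c (i, j)) (g i))"
      by (simp add: sum.cartesian_product pm_scale_mult_right case_prod_unfold)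
    also have "\<dots> = (\<Sum>j\<le>J. f ^ j * (\<Sum>i\<in>I. pm_scale (c (i, j)) (g i)))"
      by (subst sum.swap) (simp add: sum_distrib_left)
    finally show "\<forall>i\<in>I \<times> {..J}. c i = 0" using main[of "\<lambda>i j. c (i, j)"] by auto
  qed
qed

lemma indep_family_prime_step:
  fixes P Q :: "('i, 'k::field) mpoly set"
  assumes P: "primeideal P (mpoly_ring X)" and Q: "primeideal Q (mpoly_ring X)" and PQ: "P \<subset> Q"
  shows "\<exists>d. \<forall>t N J. indep_family X Q t N \<longrightarrow> indep_family X P (J * d + t) (N * (J + 1))"
proof -
  obtain f where f: "f \<in> Q" "f \<notin> P" using PQ by auto
  then have "f \<in> carrier (mpoly_ring X)"
    using ideal_mpolyD(2)[OF primeideal.axioms(1)[OF Q]] by auto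
  then obtain d where d: "f \<in> box X d" using ex_box by blast
  have "indep_family X P (J * d + t) (N * (J + 1))" if Q': "indep_family X Q t N" for t N J
  proof -
    obtain g where g: "\<And>i. i < N \<Longrightarrow> g i \<in> box X t" "indep_mod Q {..<N} g"
      using Q' by (auto simp: indep_family_def)
    have "indep_mod P ({..<N} \<times> {..J}) (\<lambda>(i, j). f ^ j * g i)"
      using g box_subset_carrier PQ f by (intro indep_mod_powers[OF P Q]) auto
    moreover have "f ^ j * g i \<in> box X (J * d + t)" if "i < N" "j \<le> J" for i j
      using box_mult[OF box_power[OF d, of j] g(1)[OF that(1)]] box_mono[of "j * d + t" "J * d + t"] that
      by auto
    ultimately have "indep_family X P (J * d + t) (card ({..<N} \<times> {..J}))"
      by (intro indep_familyI[where g = "\<lambda>(i, j). f ^ j * g i"]) auto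
    then show ?thesis by simp
  qed
  then show ?thesis by blast
qed

text \<open>
  Every step down in a chain of primes raises the order of growth of the Hilbert function by one.
\<close>
lemma indep_family_prime_chain:
  fixes C :: "nat \<Rightarrow> ('i, 'k::field) mpoly set"
  assumes "\<forall>i\<le>h. primeideal (C i) (mpoly_ring X)" "\<forall>i<h. C i \<subset> C (Suc i)"
    and "\<And>t. indep_family X (C h) t ((t + 1) ^ r)"
  shows "\<exists>K. \<forall>t. indep_family X (C 0) (t * K) ((t + 1) ^ (r + h))"
  using assms
proof (induction h arbitrary: C)
  case 0
  then show ?case by (intro exI[of _ 1]) auto
next
  case (Suc h)
  have "\<exists>K. \<forall>t. indep_family X (C (Suc 0)) (t * K) ((t + 1) ^ (r + h))"
    using Suc.prems by (intro Suc.IH[of "\<lambda>i. C (Suc i)"]) auto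
  then obtain K where K: "\<And>t. indep_family X (C (Suc 0)) (t * K) ((t + 1) ^ (r + h))" by blast
  obtain d where d: "\<And>t N J. indep_family X (C (Suc 0)) t N \<Longrightarrow>
      indep_family X (C 0) (J * d + t) (N * (J + 1))"
    using indep_family_prime_step[of "C 0" X "C (Suc 0)"] Suc.prems(1,2) by blast
  have "indep_family X (C 0) (t * (d + K)) ((t + 1) ^ (r + Suc h))" for t
    using d[OF K[of t], of t] by (simp add: algebra_simps)
  then show ?case by blast
qed

lemma power_growth_bound:
  assumes "\<And>t::nat. (t + 1) ^ a \<le> (t * K + 1) ^ b"
  shows "a \<le> b"
proof (rule ccontr)
  assume "\<not> a \<le> b"
  define t where "t = (K + 1) ^ b"
  have "(t + 1) * (t + 1) ^ b \<le> (t + 1) ^ a"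
    using \<open>\<not> a \<le> b\<close> power_increasing[of "Suc b" a "t + 1"] by simp
  also have "\<dots> \<le> (t * K + 1) ^ b" by (rule assms)
  also have "\<dots> \<le> ((K + 1) * (t + 1)) ^ b" by (intro power_mono) auto
  also have "\<dots> = t * (t + 1) ^ b" by (simp only: power_mult_distrib t_def)
  finally have "(t + 1) * (t + 1) ^ b \<le> t * (t + 1) ^ b" .
  then have "t + 1 \<le> t" by (rule mult_right_le_imp_le) simp
  then show False by simp
qed

text \<open>
  The number of monomials with exponents at most \<open>t\<close> grows like the power \<open>card X\<close> of \<open>t\<close>. Hence a
  prime whose residue ring has growth of order \<open>r\<close> ends no chain of length greater than \<open>card X - r\<close>.
\<close>
lemma prime_height_le:
  fixes P :: "('i, 'k::field) mpoly set"
  assumes X: "finite X" and fam: "\<And>t. indep_family X P t ((t + 1) ^ r)"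
  shows "prime_height (mpoly_ring X) P \<le> enat (card X - r)"
  unfolding prime_height_def
proof (rule Sup_least, clarsimp)
  fix h and C :: "nat \<Rightarrow> ('i, 'k) mpoly set"
  assume C: "\<forall>i\<le>h. primeideal (C i) (mpoly_ring X)" "\<forall>i<h. C i \<subset> C (Suc i)" "P = C h"
  obtain K where K: "\<And>t. indep_family X (C 0) (t * K) ((t + 1) ^ (r + h))"
    using indep_family_prime_chain[OF C(1,2)] fam C(3) by blast
  have "0 \<in> C 0"
    using C(1) by (intro pm.subspace_0 ideal_mpolyD(1)[OF primeideal.axioms(1)]) auto
  then have "(t + 1) ^ (r + h) \<le> (t * K + 1) ^ card X" for t
    using indep_family_le[OF X K] by simp
  then have "r + h \<le> card X" by (rule power_growth_bound)
  then show "h \<le> card X - r" by simp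
qed

section \<open>The rank of the incidence vectors\<close>

definition incidence :: "'a set \<Rightarrow> 'a \<Rightarrow>\<^sub>0 rat" where
  "incidence e = (\<Sum>v\<in>e. single v 1)"

lemma lookup_incidence: "finite e \<Longrightarrow> lookup (incidence e) v = (if v \<in> e then 1 else 0)"
  by (simp add: incidence_def lookup_sum lookup_single when_def)

definition incidence_rank :: "'a set set \<Rightarrow> nat" where
  "incidence_rank E = pm.dim (incidence ` E)"

lemma inj_on_incidence:
  assumes "\<And>e. e \<in> E \<Longrightarrow> finite e"
  shows "inj_on incidence E"
proof (rule inj_onI)
  fix e f assume ef: "e \<in> E" "f \<in> E" "incidence e = incidence f"
  have "v \<in> e \<longleftrightarrow> v \<in> f" for v
    using lookup_incidence[OF assms[OF ef(1)], of v] lookup_incidence[OF assms[OF ef(2)], of v] ef(3)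
    by (simp split: if_splits)
  then show "e = f" by blast
qed

lemma incidence_basis:
  assumes "\<And>e. e \<in> E \<Longrightarrow> finite e"
  obtains B where "B \<subseteq> E" "pm.independent (incidence ` B)" "incidence ` E \<subseteq> pm.span (incidence ` B)"
    "card B = incidence_rank E"
proof -
  obtain C where C: "C \<subseteq> incidence ` E" "pm.independent C" "incidence ` E \<subseteq> pm.span C"
    "card C = incidence_rank E"
    using pm.basis_exists[of "incidence ` E"] unfolding incidence_rank_def by metis
  let ?B = "{e \<in> E. incidence e \<in> C}"
  have B: "incidence ` ?B = C" using C(1) by auto
  have "inj_on incidence ?B" using assms by (intro inj_on_incidence) auto
  then have "card ?B = card C" using B card_image by metis
  then show thesis using C B by (intro that[of ?B]) auto
qed

lemma independent_imageD:
  assumes ind: "pm.independent (g ` I)" and inj: "inj_on g I" and I: "finite I"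
    and z: "(\<Sum>i\<in>I. pm_scale (c i) (g i)) = 0" and i: "i \<in> I"
  shows "c i = 0"
proof -
  let ?u = "\<lambda>v. c (the_inv_into I g v)"
  have "(\<Sum>v\<in>g ` I. pm_scale (?u v) v) = (\<Sum>i\<in>I. pm_scale (c i) (g i))"
    by (simp add: sum.reindex[OF inj] the_inv_into_f_f[OF inj])
  then have "?u (g i) = 0"
    using z i I by (intro pm.independentD[OF ind, of "g ` I"]) auto
  then show ?thesis by (simp add: the_inv_into_f_f[OF inj i])
qed

text \<open>
  The vertex degrees of a monomial are the combination of incidence vectors whose coefficients are the
  exponents, so linearly independent edges determine the monomial.
\<close>
lemma inj_on_vdeg:
  assumes B: "finite B" "\<And>e. e \<in> B \<Longrightarrow> finite e" and ind: "pm.independent (incidence ` B)"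
  shows "inj_on vdeg {m. keys m \<subseteq> B}"
proof (rule inj_onI, clarify)
  fix m n :: "'a set \<Rightarrow>\<^sub>0 nat" assume mn: "keys m \<subseteq> B" "keys n \<subseteq> B" "vdeg m = vdeg n"
  let ?c = "\<lambda>e. rat_of_nat (lookup m e) - rat_of_nat (lookup n e)"
  have deg: "(\<Sum>e\<in>B. rat_of_nat (lookup l e) * lookup (incidence e) v) = rat_of_nat (vdeg l v)"
    if "keys l \<subseteq> B" for l v
  proof -
    have "rat_of_nat (vdeg l v) = rat_of_nat (\<Sum>e\<in>B. lookup l e * (if v \<in> e then 1 else 0))"
      unfolding vdeg_def using wsum_superset[OF B(1) that] by metis
    also have "\<dots> = (\<Sum>e\<in>B. rat_of_nat (lookup l e) * lookup (incidence e) v)"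
      using B(2) by (auto simp: lookup_incidence intro!: sum.cong)
    finally show ?thesis by simp
  qed
  have "(\<Sum>e\<in>B. pm_scale (?c e) (incidence e)) = 0"
    using deg[OF mn(1)] deg[OF mn(2)] mn(3)
    by (intro poly_mapping_eqI) (simp add: lookup_sum left_diff_distrib sum_subtractf)
  then have c: "?c e = 0" if "e \<in> B" for e
    using independent_imageD[OF ind inj_on_incidence[OF B(2)] B(1), where c = ?c] that by blast
  show "m = n"
  proof (rule poly_mapping_eqI)
    fix e
    show "lookup m e = lookup n e"
    proof (cases "e \<in> B")
      case True
      then show ?thesis using c by auto
    next
      case False
      then have "e \<notin> keys m" "e \<notin> keys n" using mn by auto
      then show ?thesis by (simp add: in_keys_iff)
    qed
  qed
qed

lemma finite_edges: "simple_graph V E \<Longrightarrow> finite E"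
  using simple_graph_edge(2) by (intro finite_subset[of E "Pow V"]) (auto simp: simple_graph_def)

text \<open>
  Monomials in a maximal linearly independent set of edges are independent modulo the toric ideal, since
  they have pairwise different images.
\<close>
lemma indep_family_toric:
  assumes "simple_graph V E"
  shows "indep_family E (toric_set E :: ('a set, 'k::field) mpoly set) t ((t + 1) ^ incidence_rank E)"
proof -
  have fin: "finite E" "\<And>e. e \<in> E \<Longrightarrow> finite e"
    using assms finite_edges simple_graph_edge by auto
  obtain B where B: "B \<subseteq> E" "pm.independent (incidence ` B)" "card B = incidence_rank E"
    using incidence_basis[of E] fin(2) by metis
  have finB: "finite B" using B(1) fin(1) by (rule finite_subset)
  have inj: "inj_on vdeg {m. keys m \<subseteq> B}" using finB B fin by (intro inj_on_vdeg) auto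
  let ?I = "exponent_box B t"
  have "indep_mod (toric_set E) ?I (\<lambda>m. single m (1::'k))"
    unfolding indep_mod_def
  proof (intro allI impI ballI)
    fix c n assume *: "(\<Sum>m\<in>?I. pm_scale (c m) (single m (1::'k))) \<in> toric_set E" and n: "n \<in> ?I"
    have "0 = wsum (\<lambda>m. if vdeg m = vdeg n then 1 else 0) (\<Sum>m\<in>?I. pm_scale (c m) (single m (1::'k)))"
      using * by (simp add: toric_set_def)
    also have "\<dots> = (\<Sum>m\<in>?I. c m * (if vdeg m = vdeg n then 1 else 0))"
      by (simp add: wsum_sum)
    also have "\<dots> = (\<Sum>m\<in>?I. if m = n then c m else 0)"
      using inj n by (intro sum.cong) (auto simp: inj_on_def exponent_box_def)
    also have "\<dots> = c n" using n card_exponent_box[OF finB] by simp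
    finally show "c n = 0" by simp
  qed
  then have "indep_family E (toric_set E :: ('a set, 'k::field) mpoly set) t (card ?I)"
    using card_exponent_box[OF finB] B(1)
    by (intro indep_familyI) (auto simp: exponent_box_def box_def)
  then show ?thesis using card_exponent_box[OF finB] B(3) by simp
qed

lemma ideal_height_toric_le:
  assumes "simple_graph V E"
  shows "ideal_height (mpoly_ring E) (toric_set E :: ('a set, 'k::field) mpoly set)
    \<le> enat (card E - incidence_rank E)"
proof -
  have "ideal_height (mpoly_ring E) (toric_set E :: ('a set, 'k) mpoly set)
      \<le> prime_height (mpoly_ring E) (toric_set E :: ('a set, 'k) mpoly set)"
    unfolding ideal_height_def by (rule Inf_lower) (use primeideal_toric_set[OF assms] in blast)
  also have "\<dots> \<le> enat (card E - incidence_rank E)"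
    using assms by (intro prime_height_le finite_edges indep_family_toric)
  finally show ?thesis .
qed

lemma common_denominator:
  fixes c :: "'x \<Rightarrow> rat"
  assumes "finite A"
  shows "\<exists>N z. N > 0 \<and> (\<forall>x\<in>A. of_nat N * c x = of_int (z x))"
proof -
  define D where "D x = snd (quotient_of (c x))" for x
  have D: "D x > 0" "of_int (D x) * c x = of_int (fst (quotient_of (c x)))" for x
  proof -
    show "D x > 0" unfolding D_def by (rule quotient_of_denom_pos')
    then show "of_int (D x) * c x = of_int (fst (quotient_of (c x)))"
      using quotient_of_div[of "c x" "fst (quotient_of (c x))" "D x"] by (simp add: D_def field_simps)
  qed
  let ?N = "\<Prod>x\<in>A. D x"
  have N: "?N > 0" by (intro prod_pos) (use D in auto)
  have "of_nat (nat ?N) * c x = of_int ((\<Prod>y\<in>A - {x}. D y) * fst (quotient_of (c x)))" if "x \<in> A" for x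
  proof -
    have "of_nat (nat ?N) * c x = of_int ?N * c x" using N by simp
    also have "\<dots> = of_int (\<Prod>y\<in>A - {x}. D y) * (of_int (D x) * c x)"
      using prod.remove[OF assms that, of D] by (simp add: mult_ac)
    finally show ?thesis unfolding D(2) by simp
  qed
  then show ?thesis
    using N by (intro exI[of _ "nat ?N"]
      exI[of _ "\<lambda>x. (\<Prod>y\<in>A - {x}. D y) * fst (quotient_of (c x))"]) auto
qed

definition exponent_vector :: "('x \<Rightarrow>\<^sub>0 nat) \<Rightarrow> 'x \<Rightarrow>\<^sub>0 rat" where
  "exponent_vector m = Poly_Mapping.map of_nat m"

lemma lookup_exponent_vector [simp]: "lookup (exponent_vector m) x = of_nat (lookup m x)"
  by (simp add: exponent_vector_def map.rep_eq when_def)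

lemma exponent_vector_add: "exponent_vector (m + n) = exponent_vector m + exponent_vector n"
  by (rule poly_mapping_eqI) (simp add: lookup_add)

text \<open>
  Call two monomials equivalent if the difference of their exponents lies in the span \<open>U\<close> of the
  differences that occur in \<open>S\<close>. Multiples of elements of \<open>S\<close> have coefficient sum \<open>0\<close> on every class,
  in particular on the class of \<open>p\<close>. The binomial \<open>x\<^sup>p - x\<^sup>q\<close> inherits this, so \<open>q\<close> is in that class.
\<close>
lemma binomial_difference_in_span:
  fixes S :: "('a set, 'k::field) mpoly set"
  assumes S: "\<And>s. s \<in> S \<Longrightarrow> s = single (a s) 1 - single (b s) 1"
    and pq: "single p 1 - single q 1 \<in> pm.span (monomial_multiples E S)"
  shows "exponent_vector p - exponent_vector q \<in>
    pm.span ((\<lambda>s. exponent_vector (a s) - exponent_vector (b s)) ` S)" (is "_ \<in> ?U")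
proof -
  let ?w = "\<lambda>m. if exponent_vector p - exponent_vector m \<in> ?U then 1 else (0::'k)"
  have "monomial_multiples E S \<subseteq> {f. wsum ?w f = 0}"
  proof (clarsimp simp: monomial_multiples_def)
    fix m s assume s: "s \<in> S"
    have "exponent_vector (a s) - exponent_vector (b s) \<in> ?U" using s by (intro pm.span_base) auto
    from pm.span_diff[OF _ this] pm.span_add[OF _ this]
    have "exponent_vector p - exponent_vector (m + a s) \<in> ?U \<longleftrightarrow>
        exponent_vector p - exponent_vector (m + b s) \<in> ?U"
      by (smt (verit) add_diff_cancel_left add_diff_eq diff_add_eq diff_diff_eq2 exponent_vector_add
          diff_diff_add add.commute)
    then have "wsum ?w (single m 1 * (single (a s) 1 - single (b s) 1)) = 0"
      by (simp add: wsum_monomial_mult wsum_diff)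
    then show "wsum ?w (single m 1 * s) = 0" using S[OF s] by simp
  qed
  then have "pm.span (monomial_multiples E S) \<subseteq> {f. wsum ?w f = 0}"
    by (rule pm.span_minimal[OF _ subspace_wsum])
  then have "wsum ?w (single p 1 - single q 1) = 0" using pq by auto
  then show ?thesis by (simp add: wsum_diff pm.span_zero split: if_splits)
qed

text \<open>
  This bounds the number of binomial generators from below by the dimension \<open>card E - rank\<close> of the space
  of relations between incidence vectors. Fix a basis \<open>B\<close> of edges. Each other edge \<open>e\<close> is a rational
  combination of \<open>B\<close>; clearing denominators and separating positive from negative coefficients gives a
  binomial whose exponent difference contains no edge outside \<open>B\<close> besides \<open>e\<close>. These differences are
  independent, and they lie in the span of those of the generators.
\<close>
lemma card_edges_le_generators:
  fixes S :: "('a set, 'k::field) mpoly set"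
  assumes E: "finite E" "\<And>e. e \<in> E \<Longrightarrow> finite e" and S: "finite S" "S \<subseteq> binomials E"
    and gen: "binomials E \<subseteq> pm.span (monomial_multiples E S)"
  shows "card E \<le> card S + incidence_rank E"
proof -
  have "\<forall>s\<in>S. \<exists>a b. s = single a 1 - single b 1" using S(2) unfolding binomials_def by blast
  then obtain a b where ab: "\<And>s. s \<in> S \<Longrightarrow> s = single (a s) 1 - single (b s) 1" by metis
  let ?D = "(\<lambda>s. exponent_vector (a s) - exponent_vector (b s)) ` S"
  obtain B where B: "B \<subseteq> E" "incidence ` E \<subseteq> pm.span (incidence ` B)" "card B = incidence_rank E"
    using incidence_basis[of E] E(2) by metis
  have finB: "finite B" using B(1) E(1) by (rule finite_subset)
  have inj: "inj_on incidence B" using B E by (intro inj_on_incidence) auto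
  have ex: "\<exists>u. u \<in> pm.span ?D \<and> (\<forall>f\<in>E - B. lookup u f \<noteq> 0 \<longleftrightarrow> f = e)" if e: "e \<in> E - B" for e
  proof -
    have "incidence e \<in> pm.span (incidence ` B)" using e B by auto
    then obtain c where "incidence e = (\<Sum>v\<in>incidence ` B. pm_scale (c v) v)"
      using pm.span_finite[of "incidence ` B"] finB by auto
    then have c: "incidence e = (\<Sum>f\<in>B. pm_scale (c (incidence f)) (incidence f))"
      by (simp add: sum.reindex[OF inj])
    obtain N z where N: "N > 0" and z: "\<And>f. f \<in> B \<Longrightarrow> of_nat N * c (incidence f) = of_int (z f)"
      using common_denominator[OF finB, of "\<lambda>f. c (incidence f)"] by auto
    \<comment> \<open>The relation \<open>N e = \<Sum>f\<in>B. z f\<close> with its negative coefficients moved to the left.\<close>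
    let ?p = "single e N + (\<Sum>f\<in>B. single f (nat (- z f)))"
    let ?q = "\<Sum>f\<in>B. single f (nat (z f))"
    have lk: "lookup (\<Sum>f\<in>B. single f (h f)) g = (if g \<in> B then h g else 0)" for h :: "'a set \<Rightarrow> nat" and g
      using finB by (simp add: lookup_sum lookup_single when_def)
    have keys: "keys ?p \<subseteq> E" "keys ?q \<subseteq> E"
      using e B(1) by (auto simp: in_keys_iff lookup_add lk lookup_single when_def split: if_splits)
    have "vdeg ?p = vdeg ?q"
    proof
      fix v
      have "int N * (if v \<in> e then 1 else 0) = (\<Sum>f\<in>B. z f * (if v \<in> f then 1 else 0))"
      proof -
        have "rat_of_nat N * lookup (incidence e) v =
            (\<Sum>f\<in>B. of_nat N * c (incidence f) * lookup (incidence f) v)"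
          unfolding c by (simp add: lookup_sum sum_distrib_left mult.assoc)
        also have "\<dots> = (\<Sum>f\<in>B. of_int (z f) * lookup (incidence f) v)" by (simp add: z)
        finally have "rat_of_int (int N * (if v \<in> e then 1 else 0)) =
            rat_of_int (\<Sum>f\<in>B. z f * (if v \<in> f then 1 else 0))"
          using E(2) e B(1) by (simp add: lookup_incidence subset_iff if_distrib[of rat_of_int] cong: if_cong)
        then show ?thesis by (simp only: of_int_eq_iff)
      qed
      also have "\<dots> = (\<Sum>f\<in>B. int (nat (z f)) * (if v \<in> f then 1 else 0)) -
          (\<Sum>f\<in>B. int (nat (- z f)) * (if v \<in> f then 1 else 0))"
        by (subst sum_subtractf[symmetric], rule sum.cong) auto
      finally have "int (vdeg ?p v) = int (vdeg ?q v)"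
        by (simp add: vdeg_def wsum_add wsum_sum if_distrib[of int] cong: if_cong)
      then show "vdeg ?p v = vdeg ?q v" by simp
    qed
    then have "single ?p 1 - single ?q 1 \<in> binomials E" using keys by (auto simp: binomials_def)
    then have "exponent_vector ?p - exponent_vector ?q \<in> pm.span ?D"
      using gen by (intro binomial_difference_in_span[of S a b ?p ?q E] ab) auto
    moreover have "\<forall>f\<in>E - B. lookup (exponent_vector ?p - exponent_vector ?q) f \<noteq> 0 \<longleftrightarrow> f = e"
      using N by (auto simp: lookup_minus lookup_add lk lookup_single when_def)
    ultimately show ?thesis by blast
  qed
  have "\<exists>u. \<forall>e\<in>E - B. u e \<in> pm.span ?D \<and> (\<forall>f\<in>E - B. lookup (u e) f \<noteq> 0 \<longleftrightarrow> f = e)"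
    by (rule bchoice, rule ballI, rule ex)
  then obtain u where *: "\<forall>e\<in>E - B. u e \<in> pm.span ?D \<and> (\<forall>f\<in>E - B. lookup (u e) f \<noteq> 0 \<longleftrightarrow> f = e)"
    by (rule exE)
  have u: "u e \<in> pm.span ?D" "f \<in> E - B \<Longrightarrow> lookup (u e) f \<noteq> 0 \<longleftrightarrow> f = e"
    if "e \<in> E - B" for e f
    using *[rule_format, OF that] by (rule conjunct1, elim conjE) (rule bspec)
  have z: "c f = 0" if "(\<Sum>e\<in>E - B. pm_scale (c e) (u e)) = 0" "f \<in> E - B" for c f
  proof -
    have "0 = lookup (\<Sum>e\<in>E - B. pm_scale (c e) (u e)) f" using that(1) by simp
    also have "\<dots> = (\<Sum>e\<in>E - B. if e = f then c f * lookup (u f) f else 0)"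
      unfolding lookup_sum using u(2)[OF _ that(2)] by (intro sum.cong) auto
    also have "\<dots> = c f * lookup (u f) f" using that(2) E(1) by (subst sum.delta) auto
    finally show ?thesis using u(2)[OF that(2,2)] by simp
  qed
  have inj_u: "inj_on u (E - B)" and ind_u: "pm.independent (u ` (E - B))"
    by (rule independent_image_if_scalars_zero[of "E - B" u]; use E(1) z in blast)+
  have "card (u ` (E - B)) \<le> card ?D"
    using pm.independent_span_bound[OF _ ind_u, of ?D] S(1) u(1) by blast
  also have "\<dots> \<le> card S" using S(1) by (rule card_image_le)
  finally have "card (E - B) \<le> card S" by (simp add: card_image[OF inj_u])
  then show ?thesis using B(1,3) finB by (simp add: card_Diff_subset)
qed

lemma incidence_in_span_units:
  "finite e \<Longrightarrow> e \<subseteq> V \<Longrightarrow> incidence e \<in> pm.span ((\<lambda>v. single v 1) ` V)"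
  unfolding incidence_def by (intro pm.span_sum pm.span_base) auto

lemma incidence_rank_le:
  assumes "finite V" "\<And>e. e \<in> E \<Longrightarrow> e \<subseteq> V"
  shows "incidence_rank E \<le> card V"
proof -
  have "incidence ` E \<subseteq> pm.span ((\<lambda>v. single v 1) ` V)"
    using assms(2) finite_subset[OF assms(2) assms(1)] by (auto intro!: incidence_in_span_units)
  then have "incidence_rank E \<le> card ((\<lambda>v. single v (1::rat)) ` V)"
    unfolding incidence_rank_def using assms(1) by (intro pm.dim_le_card) auto
  also have "\<dots> \<le> card V" using assms(1) by (rule card_image_le)
  finally show ?thesis .
qed

text \<open>
  The incidence vector of an edge at \<open>v\<close> is independent of the edges that avoid \<open>v\<close>, since only it has
  a nonzero entry at \<open>v\<close>.
\<close>
lemma incidence_rank_delete_vertex: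
  assumes E: "finite E" "\<And>e. e \<in> E \<Longrightarrow> finite e" and e: "e \<in> E" "v \<in> e"
  shows "incidence_rank {f \<in> E. v \<notin> f} + 1 \<le> incidence_rank E"
proof -
  let ?E = "{f \<in> E. v \<notin> f}"
  obtain B where B: "B \<subseteq> ?E" "pm.independent (incidence ` B)" "card B = incidence_rank ?E"
    by (rule incidence_basis[of ?E]) (use E(2) in auto)
  obtain C where C: "C \<subseteq> E" "incidence ` E \<subseteq> pm.span (incidence ` C)" "card C = incidence_rank E"
    using incidence_basis[of E] E(2) by metis
  have "B \<subseteq> E" using B(1) by auto
  then have inj: "inj_on incidence (insert e B)" using E(2) e by (intro inj_on_incidence) auto
  have "pm.subspace {x. lookup x v = (0::rat)}"
    by (rule pm.subspaceI) (auto simp: lookup_add)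
  then have "pm.span (incidence ` B) \<subseteq> {x. lookup x v = 0}"
    using B(1) E(2) by (intro pm.span_minimal) (auto simp: lookup_incidence)
  then have ne: "incidence e \<notin> pm.span (incidence ` B)"
    using E(2) e by (auto simp: lookup_incidence)
  have "card (insert e B) = card (incidence ` insert e B)" using card_image[OF inj] by simp
  also have "\<dots> \<le> card (incidence ` C)"
  proof -
    have "finite (incidence ` C)" using C(1) E(1) finite_subset by blast
    moreover have "pm.independent (incidence ` insert e B)"
      using pm.independent_insertI[OF ne B(2)] by simp
    moreover have "incidence ` insert e B \<subseteq> pm.span (incidence ` C)"
      using C(2) e(1) \<open>B \<subseteq> E\<close> by blast
    ultimately show ?thesis using pm.independent_span_bound by blast
  qed
  also have "\<dots> \<le> card C" using C(1) E(1) finite_subset by (intro card_image_le) blast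
  finally show ?thesis
    using B(1,3) C(3) e finite_subset[OF \<open>B \<subseteq> E\<close> E(1)] by (auto simp: card_insert_if split: if_splits)
qed

lemma units_in_span_if_full_rank:
  assumes V: "finite V" "\<And>e. e \<in> E \<Longrightarrow> e \<subseteq> V" and r: "incidence_rank E = card V" and w: "w \<in> V"
  shows "single w 1 \<in> pm.span (incidence ` E)"
proof (rule ccontr)
  assume w': "single w 1 \<notin> pm.span (incidence ` E)"
  have fin: "\<And>e. e \<in> E \<Longrightarrow> finite e" "finite E"
    using V finite_subset[of _ V] finite_subset[of E "Pow V"] by auto
  obtain B where B: "B \<subseteq> E" "pm.independent (incidence ` B)" "card B = card V"
    using incidence_basis[of E] fin r by metis
  have finB: "finite B" using B(1) fin(2) by (rule finite_subset)
  have "inj_on incidence B" using B(1) fin by (intro inj_on_incidence) auto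
  then have cB: "card (incidence ` B) = card V" using B(3) card_image by metis
  have w'': "single w 1 \<notin> pm.span (incidence ` B)"
    using w' pm.span_mono[of "incidence ` B" "incidence ` E"] B(1) by blast
  then have ind: "pm.independent (insert (single w 1) (incidence ` B))"
    by (rule pm.independent_insertI[OF _ B(2)])
  have "incidence e \<in> pm.span ((\<lambda>v. single v 1) ` V)" if "e \<in> B" for e
    using that V B(1) fin by (intro incidence_in_span_units) auto
  then have "insert (single w 1) (incidence ` B) \<subseteq> pm.span ((\<lambda>v. single v 1) ` V)"
    using w by (auto intro: pm.span_base)
  then have "card (insert (single w 1) (incidence ` B)) \<le> card ((\<lambda>v. single v (1::rat)) ` V)"
    using pm.independent_span_bound[OF _ ind] V(1) by blast
  also have "\<dots> \<le> card V" using V(1) by (rule card_image_le)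
  finally have "card (insert (single w 1) (incidence ` B)) \<le> card V" .
  moreover have "single w 1 \<notin> incidence ` B" using w'' pm.span_base by blast
  ultimately show False using cB finB by simp
qed

text \<open>
  For a bipartite component with parts \<open>X\<close> and \<open>Y\<close>, the functional that adds the entries in \<open>X\<close> and
  subtracts those in \<open>Y\<close> vanishes on all incidence vectors, but not on the unit vectors of the component,
  which full rank puts into their span.
\<close>
lemma no_bipartite_component:
  assumes G: "simple_graph V E" and r: "incidence_rank E = card V"
  shows "num_bipartite_components V E = 0"
proof -
  let ?R = "{(u, w). {u, w} \<in> E}\<^sup>*"
  have "\<not> bipartite_graph C (induced_edges E C)" if C: "C \<in> graph_components V E" for C
  proof
    assume "bipartite_graph C (induced_edges E C)"
    then obtain X Y where XY: "X \<union> Y = C" "X \<inter> Y = {}"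
      "\<And>e. e \<in> E \<Longrightarrow> e \<subseteq> C \<Longrightarrow> \<exists>x\<in>X. \<exists>y\<in>Y. e = {x, y}"
      by (auto simp: bipartite_graph_def induced_edges_def)
    obtain x where x: "x \<in> V" "C = ?R `` {x}"
      using C by (auto simp: graph_components_def quotient_def)
    let ?w = "\<lambda>v. if v \<in> X then 1 else if v \<in> Y then -1 else (0::rat)"
    have "wsum ?w (incidence e) = 0" if e: "e \<in> E" for e
    proof -
      obtain p q where pq: "e = {p, q}" "p \<noteq> q" using G e by (auto simp: simple_graph_def)
      have "{q, p} \<in> E" "{p, q} \<in> E" using pq e by (simp_all add: insert_commute)
      then have "p \<in> C \<longleftrightarrow> q \<in> C" unfolding x(2)
        by (auto intro: rtrancl_into_rtrancl)
      then consider "e \<subseteq> C" | "p \<notin> C" "q \<notin> C" using pq by auto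
      then have "?w p + ?w q = 0"
      proof cases
        case 1
        then show ?thesis using XY(3)[OF e 1] XY(2) pq by (auto simp: doubleton_eq_iff)
      next
        case 2
        then show ?thesis using XY(1) by auto
      qed
      then show ?thesis unfolding incidence_def pq(1) using pq(2) by (simp add: wsum_add)
    qed
    then have "pm.span (incidence ` E) \<subseteq> {p. wsum ?w p = 0}"
      by (intro pm.span_minimal subspace_wsum) auto
    moreover have "single x 1 \<in> pm.span (incidence ` E)"
      using G r x simple_graph_edge(2)[OF G] by (intro units_in_span_if_full_rank) (auto simp: simple_graph_def)
    ultimately have "wsum ?w (single x 1) = 0" by blast
    moreover have "x \<in> X \<union> Y" unfolding XY(1) x(2) by auto
    ultimately show False by (auto split: if_splits)
  qed
  then have "{C \<in> graph_components V E. bipartite_graph C (induced_edges E C)} = {}" by blast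
  then show ?thesis unfolding num_bipartite_components_def by (simp only: card.empty)
qed

section \<open>Minimal binomial generators\<close>

definition tdeg :: "('a set \<Rightarrow>\<^sub>0 nat) \<Rightarrow> nat" where
  "tdeg m = wsum (\<lambda>_. 1) m"

lemma tdeg_add: "tdeg (m + n) = tdeg m + tdeg n"
  by (simp add: tdeg_def wsum_add)

lemma tdeg_eq_0_iff: "tdeg m = 0 \<longleftrightarrow> m = 0"
  by (auto simp: tdeg_def wsum_def in_keys_iff intro!: poly_mapping_eqI)

lemma sum_vdeg:
  assumes G: "simple_graph V E" and m: "keys m \<subseteq> E"
  shows "(\<Sum>v\<in>V. vdeg m v) = 2 * tdeg m"
proof -
  have V: "finite V" using G by (simp add: simple_graph_def)
  have "(\<Sum>v\<in>V. vdeg m v) = (\<Sum>e\<in>keys m. lookup m e * (\<Sum>v\<in>V. if v \<in> e then 1 else 0))"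
    unfolding vdeg_def wsum_def by (subst sum.swap) (simp add: sum_distrib_left)
  also have "\<dots> = (\<Sum>e\<in>keys m. lookup m e * 2)"
  proof (intro sum.cong refl)
    fix e assume "e \<in> keys m"
    then have e: "e \<subseteq> V" "card e = 2" using simple_graph_edge[OF G] m by auto
    have "(\<Sum>v\<in>V. if v \<in> e then 1 else 0) = card (V \<inter> {v. v \<in> e})"
      using V by (simp add: sum.If_cases)
    also have "V \<inter> {v. v \<in> e} = e" using e by auto
    finally show "lookup m e * (\<Sum>v\<in>V. if v \<in> e then 1 else 0) = lookup m e * 2" using e by simp
  qed
  finally show ?thesis by (simp add: tdeg_def wsum_def sum_distrib_left mult.commute)
qed

lemma tdeg_eq_if_vdeg_eq:
  assumes "simple_graph V E" "keys a \<subseteq> E" "keys b \<subseteq> E" "vdeg a = vdeg b"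
  shows "tdeg a = tdeg b"
  using sum_vdeg[OF assms(1,2)] sum_vdeg[OF assms(1,3)] assms(4) by simp

text \<open>
  Their span is the product of the toric ideal \<open>P\<close> with the ideal \<open>M\<close> of the variables, so a minimal
  set of generators is a basis of a complement of this span in \<open>P\<close>.
\<close>
definition proper_multiples :: "'a set set \<Rightarrow> ('a set, 'k::field) mpoly set" where
  "proper_multiples E = {single m 1 * s | m s. m \<noteq> 0 \<and> keys m \<subseteq> E \<and> s \<in> binomials E}"

lemma monomial_times_binomial:
  "single m 1 * (single a 1 - single b (1::'k::field)) = single (m + a) 1 - single (m + b) 1"
  for m :: "'i \<Rightarrow>\<^sub>0 nat"
  by (simp add: right_diff_distrib mult_single)

lemma proper_multiple_in_span:
  fixes p :: "('a set, 'k::field) mpoly"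
  assumes m: "m \<noteq> 0" "keys m \<subseteq> E" and p: "p \<in> toric_set E"
  shows "single m 1 * p \<in> pm.span (proper_multiples E)"
proof -
  have "pm.subspace {p :: ('a set, 'k) mpoly. single m 1 * p \<in> pm.span (proper_multiples E)}"
    by (rule pm.subspaceI)
      (auto simp: distrib_left pm_scale_mult_right intro: pm.span_zero pm.span_add pm.span_scale)
  moreover have "single m 1 * s \<in> pm.span (proper_multiples E)" if "s \<in> binomials E" for s
    using that m by (intro pm.span_base) (auto simp: proper_multiples_def)
  ultimately show ?thesis
    using pm.span_subspace_induct[of p "binomials E"] p unfolding toric_set_eq_span by blast
qed

lemma proper_multiples_subset: "proper_multiples E \<subseteq> binomials E"
proof
  fix q :: "('a set, 'k::field) mpoly" assume "q \<in> proper_multiples E"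
  then obtain m a b where *: "q = single m 1 * (single a 1 - single b 1)" "keys m \<subseteq> E"
    "keys a \<subseteq> E" "keys b \<subseteq> E" "vdeg a = vdeg b"
    by (auto simp: proper_multiples_def binomials_def)
  have "keys (m + a) \<subseteq> E" "keys (m + b) \<subseteq> E" using * keys_add[of m a] keys_add[of m b] by auto
  then show "q \<in> binomials E"
    using * unfolding binomials_def monomial_times_binomial
    by (intro CollectI exI[of _ "m + a"] exI[of _ "m + b"]) (simp add: vdeg_add_left_cancel)
qed

text \<open>
  Graded Nakayama, by induction on the degree: in the part of degree \<open>d\<close> of a representation of a binomial
  of degree \<open>d\<close>, the proper multiples are multiples of binomials of smaller degree.
\<close>
lemma binomials_nakayama:
  fixes S :: "('a set, 'k::field) mpoly set"
  assumes G: "simple_graph V E" and S: "S \<subseteq> binomials E"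
    and span: "binomials E \<subseteq> pm.span (S \<union> proper_multiples E)"
  shows "binomials E \<subseteq> pm.span (monomial_multiples E S)"
proof -
  let ?U = "pm.span (monomial_multiples E S)"
  have U_mult: "single m 1 * u \<in> ?U" if "keys m \<subseteq> E" "u \<in> ?U" for m u
  proof -
    have *: "S \<subseteq> carrier (mpoly_ring E)"
      using S pm.span_superset[of "binomials E"] unfolding toric_set_eq_span[symmetric]
      by (auto simp: toric_set_def)
    interpret cring "mpoly_ring E :: ('a set, 'k) mpoly ring" by (rule cring_mpoly_ring)
    show ?thesis
      using ideal_mpolyD(3)[OF genideal_ideal[OF *], unfolded genideal_eq_span[OF *]] that
      by (simp add: carrier_mpoly_ring)
  qed
  have "single a 1 - single b 1 \<in> ?U"
    if "keys a \<subseteq> E" "keys b \<subseteq> E" "vdeg a = vdeg b" for a b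
    using that
  proof (induction "tdeg a" arbitrary: a b rule: less_induct)
    case less
    let ?D = "\<lambda>m. tdeg m = tdeg a"
    have t: "tdeg b = tdeg a" using tdeg_eq_if_vdeg_eq[OF G] less.prems by metis
    have "single a 1 - single b 1 \<in> pm.span (S \<union> proper_multiples E)"
      using span less.prems by (auto simp: binomials_def)
    then have "pm_filter ?D (single a 1 - single b 1) \<in> ?U"
    proof (rule pm_filter_in_subspace[OF _ pm.subspace_span])
      fix s assume s: "s \<in> S \<union> proper_multiples E"
      then have "s \<in> binomials E" using S proper_multiples_subset by blast
      then obtain p q where pq: "s = single p 1 - single q 1" "keys p \<subseteq> E" "keys q \<subseteq> E" "vdeg p = vdeg q"
        by (auto simp: binomials_def)
      have tpq: "tdeg p = tdeg q" using tdeg_eq_if_vdeg_eq[OF G] pq by metis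
      have fs: "pm_filter ?D s = (if ?D p then s else 0)"
        unfolding pq(1) by (simp add: pm_filter_diff tpq)
      show "pm_filter ?D s \<in> ?U"
      proof (cases "?D p \<and> s \<notin> S")
        case False
        have "s \<in> monomial_multiples E S" if "s \<in> S"
          using that unfolding monomial_multiples_def
          by (intro CollectI exI[of _ 0] exI[of _ s]) simp
        then show ?thesis using False fs by (auto intro: pm.span_base pm.span_zero)
      next
        case True
        then have "s \<in> proper_multiples E" using s by blast
        then obtain m c d where m: "s = single m 1 * (single c 1 - single d 1)" "m \<noteq> 0" "keys m \<subseteq> E"
          "keys c \<subseteq> E" "keys d \<subseteq> E" "vdeg c = vdeg d"
          by (auto simp: proper_multiples_def binomials_def)
        show ?thesis
        proof (cases "c = d")
          case True
          then have "s = 0" using m(1) by simp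
          then show ?thesis using fs by (simp add: pm.span_zero)
        next
          case False
          have "lookup s (m + c) = 1"
            using False unfolding m(1) monomial_times_binomial
            by (simp add: lookup_minus lookup_single when_def)
          then have "m + c = p \<or> m + c = q"
            unfolding pq(1) by (auto simp: lookup_minus lookup_single when_def split: if_splits)
          then have "tdeg m + tdeg c = tdeg a" using True tpq by (auto simp: tdeg_add[symmetric])
          moreover have "tdeg m \<noteq> 0" using m(2) by (simp add: tdeg_eq_0_iff)
          ultimately have "single c 1 - single d 1 \<in> ?U" using m by (intro less.hyps) auto
          then have "s \<in> ?U" unfolding m(1) using m(3) by (intro U_mult)
          then show ?thesis using fs by (simp add: pm.span_zero)
        qed
      qed
    qed
    then show ?case by (simp add: pm_filter_diff t)
  qed
  then show ?thesis by (auto simp: binomials_def)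
qed

text \<open>
  Extend a basis \<open>B0\<close> of \<open>M * P\<close> (the span of the proper multiples) by a set \<open>S\<close> of binomials to a basis
  of \<open>P\<close>. Modulo \<open>M * P\<close>, the ideal \<open>P\<close> is spanned by any set \<open>F\<close> of generators, so \<open>S\<close> is not larger
  than \<open>F\<close>; and \<open>S\<close> generates \<open>P\<close> by Nakayama's lemma.
\<close>
lemma minimal_binomial_generators:
  fixes F :: "('a set, 'k::field) mpoly set"
  assumes G: "simple_graph V E" and F: "finite F" "F \<subseteq> carrier (mpoly_ring E)"
    and gen: "Idl\<^bsub>mpoly_ring E\<^esub> F = toric_set E"
  obtains S :: "('a set, 'k) mpoly set" where "finite S" "card S \<le> card F" "S \<subseteq> binomials E"
    "toric_set E = pm.span (monomial_multiples E S)"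
    "\<And>s. s \<in> S \<Longrightarrow> s \<notin> pm.span (proper_multiples E)"
proof -
  let ?M = "proper_multiples E :: ('a set, 'k) mpoly set"
  obtain B0 where B0: "B0 \<subseteq> ?M" "pm.independent B0" "?M \<subseteq> pm.span B0"
    using pm.maximal_independent_subset by blast
  obtain B where B: "B0 \<subseteq> B" "B \<subseteq> binomials E" "pm.independent B" "binomials E \<subseteq> pm.span B"
    using pm.maximal_independent_subset_extend[of B0 "binomials E"] B0 proper_multiples_subset by blast
  define S where "S = B - B0"
  have FT: "F \<subseteq> toric_set E"
    using ring.genideal_self[OF cring.axioms(1)[OF cring_mpoly_ring] F(2)] gen by simp
  have sub: "toric_set E \<subseteq> pm.span (F \<union> B0)"
  proof -
    have "monomial_multiples E F \<subseteq> pm.span (F \<union> B0)"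
    proof (clarsimp simp: monomial_multiples_def)
      fix m :: "'a set \<Rightarrow>\<^sub>0 nat" and f assume m: "keys m \<subseteq> E" and f: "f \<in> F"
      show "single m 1 * f \<in> pm.span (F \<union> B0)"
      proof (cases "m = 0")
        case True
        then show ?thesis using f by (simp add: pm.span_base)
      next
        case False
        then have "single m 1 * f \<in> pm.span ?M" using proper_multiple_in_span m f FT by blast
        moreover have "pm.span ?M \<subseteq> pm.span B0" by (rule pm.span_minimal[OF B0(3) pm.subspace_span])
        moreover have "pm.span B0 \<subseteq> pm.span (F \<union> B0)" by (rule pm.span_mono) auto
        ultimately show ?thesis by blast
      qed
    qed
    then have "pm.span (monomial_multiples E F) \<subseteq> pm.span (F \<union> B0)"
      by (rule pm.span_minimal[OF _ pm.subspace_span])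
    then show ?thesis using gen genideal_eq_span[OF F(2)] by simp
  qed
  have bound: "card S' \<le> card F" if S': "finite S'" "S' \<subseteq> S" for S'
  proof -
    have "S' \<subseteq> pm.span (F \<union> B0)"
      using S' B(2) sub pm.span_superset[of "binomials E"] unfolding toric_set_eq_span S_def by blast
    then have "\<forall>s\<in>S'. \<exists>t. finite t \<and> t \<subseteq> F \<union> B0 \<and> s \<in> pm.span t"
      unfolding pm.span_explicit[of "F \<union> B0"] using pm.span_sum pm.span_scale pm.span_base
      by (smt (verit, ccfv_threshold) mem_Collect_eq subset_iff)
    then obtain t where t: "\<And>s. s \<in> S' \<Longrightarrow> finite (t s) \<and> t s \<subseteq> F \<union> B0 \<and> s \<in> pm.span (t s)"
      by metis
    \<comment> \<open>Finite dimensions are compared, so only finitely many elements of \<open>B0\<close> are retained.\<close>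
    define B1 where "B1 = (\<Union>s\<in>S'. t s) \<inter> B0"
    have B1: "finite B1" "B1 \<subseteq> B0" using t S'(1) by (auto simp: B1_def)
    have "S' \<subseteq> pm.span (F \<union> B1)"
    proof
      fix s assume s: "s \<in> S'"
      then have "t s \<subseteq> F \<union> B1" using t by (auto simp: B1_def)
      then show "s \<in> pm.span (F \<union> B1)" using t s pm.span_mono by blast
    qed
    then have "S' \<union> B1 \<subseteq> pm.span (F \<union> B1)" by (auto intro: pm.span_base)
    moreover have "pm.independent (S' \<union> B1)"
      using B1 S' B(1) by (intro pm.independent_mono[OF B(3)]) (auto simp: S_def)
    ultimately have "card (S' \<union> B1) \<le> card (F \<union> B1)"
      using pm.independent_span_bound F(1) B1(1) by (metis finite_UnI)
    also have "\<dots> \<le> card F + card B1" by (rule card_Un_le)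
    also have "card (S' \<union> B1) = card S' + card B1"
      using S' B1 by (intro card_Un_disjoint) (auto simp: S_def)
    finally show ?thesis by simp
  qed
  have finS: "finite S"
  proof (rule ccontr)
    assume "infinite S"
    then obtain S' where "S' \<subseteq> S" "card S' = Suc (card F)" "finite S'"
      using infinite_arbitrarily_large by blast
    then show False using bound[of S'] by simp
  qed
  have SE: "S \<subseteq> binomials E" using B(2) by (auto simp: S_def)
  have nak: "binomials E \<subseteq> pm.span (monomial_multiples E S)"
  proof (rule binomials_nakayama[OF G SE])
    have "pm.span B \<subseteq> pm.span (S \<union> ?M)" using B0(1) by (intro pm.span_mono) (auto simp: S_def)
    then show "binomials E \<subseteq> pm.span (S \<union> ?M)" using B(4) by blast
  qed
  have eq: "toric_set E = pm.span (monomial_multiples E S)"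
  proof
    show "toric_set E \<subseteq> pm.span (monomial_multiples E S)"
      unfolding toric_set_eq_span by (rule pm.span_minimal[OF nak pm.subspace_span])
    have "single m 1 * s \<in> toric_set E" if "keys m \<subseteq> E" "s \<in> S" for m s
    proof (rule ideal_mpolyD(3)[OF primeideal.axioms(1)[OF primeideal_toric_set[OF G]]])
      show "single m 1 \<in> carrier (mpoly_ring E)" using that(1) by (simp add: carrier_mpoly_ring)
      show "s \<in> toric_set E"
        using that(2) SE pm.span_superset[of "binomials E"] unfolding toric_set_eq_span by blast
    qed
    then have "monomial_multiples E S \<subseteq> toric_set E" by (auto simp: monomial_multiples_def)
    then show "pm.span (monomial_multiples E S) \<subseteq> toric_set E"
      by (intro pm.span_minimal subspace_toric_set)
  qed
  have "s \<notin> pm.span ?M" if s: "s \<in> S" for s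
  proof
    assume "s \<in> pm.span ?M"
    then have "s \<in> pm.span B0" using pm.span_minimal[OF B0(3) pm.subspace_span] by blast
    then have "s \<in> pm.span (B - {s})" using pm.span_mono[of B0 "B - {s}"] s B(1) by (auto simp: S_def)
    then show False using B(3) s unfolding pm.dependent_def S_def by blast
  qed
  then show thesis by (rule that[OF finS bound[OF finS order_refl] SE eq])
qed

definition poly_vertices :: "('a set, 'k::field) mpoly \<Rightarrow> 'a set" where
  "poly_vertices p = {v. \<exists>m\<in>keys p. vdeg m v \<noteq> 0}"

lemma poly_vertices_binomial:
  assumes "a \<noteq> b" "vdeg a = vdeg b"
  shows "poly_vertices (single a 1 - single b (1::'k::field)) = {v. vdeg a v \<noteq> 0}"
proof -
  have "keys (single a 1 - single b (1::'k)) = {a, b}"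
    using assms(1) by (auto simp: in_keys_iff lookup_minus lookup_single when_def split: if_splits)
  then show ?thesis using assms(2) by (auto simp: poly_vertices_def)
qed

text \<open>
  Discard from a representation of a binomial in the remaining edges all monomials with other edges.
  If a generator meets \<open>v\<close>, then both its terms contain an edge at \<open>v\<close>, so all its multiples disappear;
  if it does not, then the two terms of a multiple are kept or discarded together.
\<close>
lemma toric_set_delete_vertex:
  fixes S :: "('a set, 'k::field) mpoly set" and v :: 'a
  assumes S: "S \<subseteq> binomials E" "0 \<notin> S" and gen: "binomials E \<subseteq> pm.span (monomial_multiples E S)"
  defines "E' \<equiv> {e \<in> E. v \<notin> e}" and "S' \<equiv> {s \<in> S. v \<notin> poly_vertices s}"
  shows "S' \<subseteq> binomials E'" "binomials E' \<subseteq> pm.span (monomial_multiples E' S')"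
proof -
  have SS: "\<exists>a b. s = single a 1 - single b 1 \<and> keys a \<subseteq> E \<and> keys b \<subseteq> E \<and> vdeg a = vdeg b \<and>
    poly_vertices s = {v. vdeg a v \<noteq> 0}" if s: "s \<in> S" for s
  proof -
    obtain a b where ab: "s = single a 1 - single b 1" "keys a \<subseteq> E" "keys b \<subseteq> E" "vdeg a = vdeg b"
      using s S(1) unfolding binomials_def by blast
    moreover have "a \<noteq> b" using ab S(2) s by auto
    ultimately show ?thesis using poly_vertices_binomial by blast
  qed
  have E': "keys m \<subseteq> E' \<longleftrightarrow> keys m \<subseteq> E \<and> vdeg m v = 0" for m :: "'a set \<Rightarrow>\<^sub>0 nat"
    by (auto simp: E'_def vdeg_eq_0_iff)
  have S'E: "\<exists>a b. s = single a 1 - single b 1 \<and> keys a \<subseteq> E' \<and> keys b \<subseteq> E' \<and> vdeg a = vdeg b"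
    if "s \<in> S'" for s
    using SS[of s] that unfolding S'_def E' by (auto, metis)
  then show "S' \<subseteq> binomials E'" unfolding binomials_def by blast
  show "binomials E' \<subseteq> pm.span (monomial_multiples E' S')"
  proof
    fix p :: "('a set, 'k) mpoly" assume p: "p \<in> binomials E'"
    let ?D = "\<lambda>m. keys m \<subseteq> E'"
    have "p \<in> pm.span (monomial_multiples E S)"
      using p gen E' by (force simp: binomials_def)
    then have "pm_filter ?D p \<in> pm.span (monomial_multiples E' S')"
    proof (rule pm_filter_in_subspace[OF _ pm.subspace_span])
      fix q assume "q \<in> monomial_multiples E S"
      then obtain m s where q: "q = single m 1 * s" "keys m \<subseteq> E" "s \<in> S"
        by (auto simp: monomial_multiples_def)
      obtain a b where ab: "s = single a 1 - single b 1" "keys a \<subseteq> E" "keys b \<subseteq> E" "vdeg a = vdeg b"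
        "poly_vertices s = {v. vdeg a v \<noteq> 0}" using SS[OF q(3)] by blast
      have sub: "keys (m + a) \<subseteq> E" "keys (m + b) \<subseteq> E"
        using keys_add[of m a] keys_add[of m b] q ab by auto
      have D: "?D (m + a) \<longleftrightarrow> ?D m \<and> s \<in> S'" "?D (m + b) \<longleftrightarrow> ?D m \<and> s \<in> S'"
        using sub ab q by (auto simp: E' vdeg_add S'_def)
      have "pm_filter ?D q = (if ?D m \<and> s \<in> S' then q else 0)"
        unfolding q ab(1) monomial_times_binomial pm_filter_diff pm_filter_single
        using D by (simp add: ab(1)[symmetric])
      then show "pm_filter ?D q \<in> pm.span (monomial_multiples E' S')"
        using q by (auto simp: monomial_multiples_def intro: pm.span_base pm.span_zero)
    qed
    moreover have "pm_filter ?D p = p"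
      using p by (auto simp: binomials_def pm_filter_diff)
    ultimately show "p \<in> pm.span (monomial_multiples E' S')" by simp
  qed
qed

section \<open>The vertices of a binomial\<close>

text \<open>
  Between two monomials of equal vertex degrees, an excess of one exponent at a vertex is balanced by
  a deficit of another exponent at the same vertex.
\<close>
lemma alternating_edge:
  assumes V: "vdeg a v = vdeg b v" and e: "lookup b e < lookup a e" "v \<in> e"
  shows "\<exists>f. v \<in> f \<and> lookup a f < lookup b f"
proof (rule ccontr)
  assume "\<not> ?thesis"
  then have le: "lookup b f * (if v \<in> f then 1 else 0) \<le> lookup a f * (if v \<in> f then 1 else 0)" for f
    by (simp add: not_less)
  let ?K = "keys a \<union> keys b"
  have "e \<in> ?K" using e(1) by (auto simp: in_keys_iff)
  then have "(\<Sum>f\<in>?K. lookup b f * (if v \<in> f then 1 else 0)) <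
      (\<Sum>f\<in>?K. lookup a f * (if v \<in> f then 1 else 0))"
    using le e by (intro sum_strict_mono_ex1) auto
  then show False
    using V by (simp add: vdeg_def wsum_superset[of ?K])
qed

lemma exponent_pos_vdeg: "v \<in> e \<Longrightarrow> lookup a e \<noteq> 0 \<Longrightarrow> vdeg a v \<noteq> 0"
  by (auto simp: vdeg_eq_0_iff in_keys_iff)

lemma ex_greater_exponent:
  assumes E: "\<And>e. e \<in> keys b \<Longrightarrow> e \<noteq> {}" and eq: "vdeg a = vdeg b" "a \<noteq> b"
  shows "\<exists>e. lookup b e < lookup a e"
proof (rule ccontr)
  assume no: "\<not> ?thesis"
  then have le: "lookup a e \<le> lookup b e" for e by (simp add: not_less)
  obtain e where "lookup a e \<noteq> lookup b e" using eq(2) poly_mapping_eqI by metis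
  then have e: "lookup a e < lookup b e" using le[of e] by simp
  then obtain v where "v \<in> e" using E[of e] by (auto simp: in_keys_iff)
  then show False using alternating_edge[of b v a e] e eq(1) no by auto
qed

text \<open>
  Start with an edge \<open>{u, w}\<close> whose exponent is greater in \<open>a\<close>. It is balanced at \<open>u\<close> and \<open>w\<close> by edges
  \<open>{u, y}\<close> and \<open>{w, z}\<close> with greater exponents in \<open>b\<close>. If \<open>y = z\<close>, then balancing at \<open>y\<close> yields an edge
  \<open>{y, x}\<close> with greater exponent in \<open>a\<close>, and \<open>x\<close> is different from \<open>u\<close> and \<open>w\<close>.
\<close>
lemma four_le_card_binomial_vertices:
  assumes G: "simple_graph V E" and ab: "keys a \<subseteq> E" "keys b \<subseteq> E" "vdeg a = vdeg b" "a \<noteq> b"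
  shows "{v. vdeg a v \<noteq> 0} \<subseteq> V" "4 \<le> card {v. vdeg a v \<noteq> 0}"
proof -
  let ?W = "{v. vdeg a v \<noteq> 0}"
  show sub: "?W \<subseteq> V"
    using ab(1) simple_graph_edge(2)[OF G] unfolding vdeg_eq_0_iff by blast
  have finW: "finite ?W" using sub G finite_subset by (auto simp: simple_graph_def)
  have edge: "\<exists>w. e = {u, w} \<and> w \<noteq> u \<and> u \<in> ?W \<and> w \<in> ?W"
    if "u \<in> e" "lookup a e \<noteq> lookup b e" for e u
  proof -
    have "e \<in> keys a \<or> e \<in> keys b" using that by (auto simp: in_keys_iff)
    then have "e \<in> E" using ab by auto
    then obtain x y where "e = {x, y}" "x \<noteq> y"
      using simple_graph_edge(3)[OF G] unfolding card_2_iff by blast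
    moreover have "u = x \<or> u = y" using calculation \<open>u \<in> e\<close> by simp
    ultimately obtain w where w: "e = {u, w}" "w \<noteq> u" by (metis insert_commute)
    have "lookup a e \<noteq> 0 \<or> lookup b e \<noteq> 0" using that(2) by auto
    then have "x \<in> ?W" if "x \<in> e" for x
      using exponent_pos_vdeg[OF that, of a] exponent_pos_vdeg[OF that, of b] ab(3) by auto
    then show ?thesis using w by auto
  qed
  have ne: "e \<noteq> {}" if "e \<in> keys b" for e
    using simple_graph_edge(3)[OF G, of e] ab(2) that by auto
  obtain e where e: "lookup b e < lookup a e" using ex_greater_exponent[OF ne ab(3,4)] by blast
  then have "e \<in> E" using ab(1) by (auto simp: in_keys_iff)
  then obtain u where "u \<in> e" using simple_graph_edge(3)[OF G, of e] by fastforce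
  then obtain w where w: "e = {u, w}" "w \<noteq> u" "u \<in> ?W" "w \<in> ?W" using edge[of u e] e by auto
  obtain f where f: "u \<in> f" "lookup a f < lookup b f" using alternating_edge[of a u b e] e w ab(3) by auto
  obtain y where y: "f = {u, y}" "y \<noteq> u" "y \<in> ?W" using edge[of u f] f by auto
  have yw: "y \<noteq> w" using e f w y by auto
  obtain g where g: "w \<in> g" "lookup a g < lookup b g" using alternating_edge[of a w b e] e w ab(3) by auto
  obtain z where z: "g = {w, z}" "z \<noteq> w" "z \<in> ?W" using edge[of w g] g by auto
  have zu: "z \<noteq> u" using e g w z by (auto simp: insert_commute)
  have "\<exists>x\<in>?W. x \<notin> {u, w, y}"
  proof (cases "z = y")
    case False
    then show ?thesis using z zu by auto
  next
    case True
    obtain h where h: "y \<in> h" "lookup b h < lookup a h"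
      using alternating_edge[of b y a f] f y ab(3) by auto
    obtain x where x: "h = {y, x}" "x \<noteq> y" "x \<in> ?W" using edge[of y h] h by auto
    have "x \<noteq> u" using h f x y by (auto simp: insert_commute)
    moreover have "x \<noteq> w" using h g x z True by (auto simp: insert_commute)
    ultimately show ?thesis using x by auto
  qed
  then obtain x where x: "x \<in> ?W" "x \<notin> {u, w, y}" by blast
  have "card {u, w, y, x} = 4" using w y yw x by auto
  moreover have "{u, w, y, x} \<subseteq> ?W" using w y x by auto
  ultimately show "4 \<le> card ?W" using card_mono[OF finW] by metis
qed

lemma tdeg_single: "tdeg (single e n) = n"
  by (simp add: tdeg_def)

text \<open>
  With the abbreviations \<open>d1\<close> and \<open>d2\<close> for the two perfect matchings of \<open>p, q, r, s\<close>, write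
  \<open>a = a' + d1\<close> and \<open>b = d2 + b'\<close>. Then
  \<open>x\<^sup>a - x\<^sup>b = x\<^sup>a\<^sup>' (x\<^sup>d\<^sup>1 - x\<^sup>d\<^sup>2) + x\<^sup>d\<^sup>2 (x\<^sup>a\<^sup>' - x\<^sup>b\<^sup>')\<close>,
  where \<open>a'\<close> is not zero because the degree of \<open>a\<close> exceeds \<open>2\<close>.
\<close>
lemma exchange_in_proper_multiples:
  assumes ab: "keys a \<subseteq> E" "keys b \<subseteq> E" "vdeg a = vdeg b" and t: "2 < tdeg a"
    and d: "distinct [p, q, r, s]"
    and a: "{p, q} \<in> keys a" "{r, s} \<in> keys a" and b: "{p, r} \<in> keys b" "{q, s} \<in> keys b"
  shows "single a 1 - single b 1 \<in> pm.span (proper_multiples E :: ('a set, 'k::field) mpoly set)"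
proof -
  let ?d1 = "single {p, q} 1 + single {r, s} (1::nat)" and ?d2 = "single {p, r} 1 + single {q, s} (1::nat)"
  have a0: "a = (a - ?d1) + ?d1"
    using a d by (intro poly_mapping_eqI)
      (auto simp: lookup_add lookup_minus lookup_single when_def in_keys_iff doubleton_eq_iff)
  have b0: "b = ?d2 + (b - ?d2)"
    using b d by (intro poly_mapping_eqI)
      (auto simp: lookup_add lookup_minus lookup_single when_def in_keys_iff doubleton_eq_iff)
  define a' b' where "a' = a - ?d1" and "b' = b - ?d2"
  have a': "a = a' + ?d1" and b': "b = ?d2 + b'" using a0 b0 by (simp_all add: a'_def b'_def)
  have dd: "vdeg ?d1 = vdeg ?d2" using d by (auto simp: fun_eq_iff vdeg_add vdeg_single)
  have "vdeg a' = vdeg b'"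
    using ab(3) dd unfolding a' b' by (auto simp: fun_eq_iff vdeg_add)
  moreover have "keys a' \<subseteq> E" "keys b' \<subseteq> E"
    using ab(1,2) by (auto simp: a'_def b'_def in_keys_iff lookup_minus)
  moreover have "keys ?d1 \<subseteq> E" "keys ?d2 \<subseteq> E"
    using a b ab keys_add[of "single {p, r} (1::nat)" "single {q, s} 1"]
      keys_add[of "single {p, q} (1::nat)" "single {r, s} 1"] by auto
  moreover have "?d2 \<noteq> 0"
  proof
    assume "?d2 = 0"
    then have "lookup ?d2 {p, r} = 0" by simp
    then show False by (simp add: lookup_add)
  qed
  moreover have "a' \<noteq> 0" using t unfolding a' by (auto simp: tdeg_add tdeg_single tdeg_eq_0_iff[THEN iffD2])
  ultimately have mem: "a' \<noteq> 0" "?d2 \<noteq> 0" "keys a' \<subseteq> E" "keys ?d2 \<subseteq> E"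
    "single ?d1 1 - single ?d2 (1::'k) \<in> binomials E" "single a' 1 - single b' (1::'k) \<in> binomials E"
    using dd unfolding binomials_def by blast+
  have 1: "single a' 1 * (single ?d1 1 - single ?d2 1) \<in> (proper_multiples E :: ('a set, 'k) mpoly set)"
    using mem(1,3,5) unfolding proper_multiples_def by blast
  have 2: "single ?d2 1 * (single a' 1 - single b' 1) \<in> (proper_multiples E :: ('a set, 'k) mpoly set)"
    using mem(2,4,6) unfolding proper_multiples_def by blast
  have "single a 1 - single b (1::'k) =
      single a' 1 * (single ?d1 1 - single ?d2 1) + single ?d2 1 * (single a' 1 - single b' 1)"
    unfolding monomial_times_binomial a' b' by (simp add: add.commute)
  then show ?thesis using 1 2 by (simp add: pm.span_add pm.span_base)
qed

lemma vdeg_four: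
  assumes d: "distinct [p, q, r, s]"
    and m: "\<And>e. e \<in> keys m \<Longrightarrow> \<exists>u w. e = {u, w} \<and> u \<noteq> w \<and> u \<in> {p, q, r, s} \<and> w \<in> {p, q, r, s}"
  shows "vdeg m p = lookup m {p, q} + lookup m {p, r} + lookup m {p, s}"
proof -
  let ?A = "{{p, q}, {p, r}, {p, s}, {q, r}, {q, s}, {r, s}}"
  have "keys m \<subseteq> ?A"
  proof
    fix e assume "e \<in> keys m"
    then obtain u w where "e = {u, w}" "u \<noteq> w" "u \<in> {p, q, r, s}" "w \<in> {p, q, r, s}" using m by blast
    then show "e \<in> ?A" by (elim insertE emptyE) (simp_all add: doubleton_eq_iff)
  qed
  then have "vdeg m p = (\<Sum>e\<in>?A. lookup m e * (if p \<in> e then 1 else 0))"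
    unfolding vdeg_def by (intro wsum_superset) auto
  then show ?thesis using d by (simp add: doubleton_eq_iff)
qed

text \<open>
  Let \<open>c = a - b\<close>. The balance at the four vertices forces \<open>c\<close> to agree on the two edges of each perfect
  matching and the values on the three matchings to sum up to \<open>0\<close>. Hence one matching divides
  \<open>x\<^sup>a\<close>, another one divides \<open>x\<^sup>b\<close>, and they can be exchanged.
\<close>
lemma binomial_on_four_vertices:
  assumes G: "simple_graph V E" and ab: "keys a \<subseteq> E" "keys b \<subseteq> E" "vdeg a = vdeg b" "a \<noteq> b"
    and W: "card {v. vdeg a v \<noteq> 0} = 4" and t: "2 < tdeg a"
  shows "single a 1 - single b 1 \<in> pm.span (proper_multiples E :: ('a set, 'k::field) mpoly set)"
proof -
  let ?W = "{v. vdeg a v \<noteq> 0}"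
  have edge: "\<exists>u w. e = {u, w} \<and> u \<noteq> w \<and> u \<in> ?W \<and> w \<in> ?W" if "e \<in> keys a \<or> e \<in> keys b" for e
  proof -
    have "e \<in> E" using that ab by auto
    then obtain u w where uw: "e = {u, w}" "u \<noteq> w"
      using G unfolding simple_graph_def by blast
    have "x \<in> ?W" if "x \<in> e" for x
      using \<open>e \<in> keys a \<or> e \<in> keys b\<close> exponent_pos_vdeg[OF that, of a] exponent_pos_vdeg[OF that, of b] ab(3)
      by (auto simp: in_keys_iff)
    then show ?thesis using uw by auto
  qed
  have ne: "e \<noteq> {}" if "e \<in> keys b" for e using edge that by blast
  obtain e where e: "lookup b e < lookup a e" using ex_greater_exponent[OF ne ab(3,4)] by blast
  then have "e \<in> keys a" by (auto simp: in_keys_iff)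
  then obtain p q where pq: "e = {p, q}" "p \<noteq> q" "p \<in> ?W" "q \<in> ?W" using edge by blast
  have finW: "finite ?W" using W card.infinite by fastforce
  then have "card (?W - {p, q}) = 2" using W pq by (simp add: card_Diff_subset)
  then obtain r s where rs: "?W - {p, q} = {r, s}" "r \<noteq> s" unfolding card_2_iff by blast
  then have Weq: "?W = {p, q, r, s}" and d: "distinct [p, q, r, s]" using pq by auto
  let ?c = "\<lambda>e. int (lookup a e) - int (lookup b e)"
  have eq: "?c {x, y} + ?c {x, z} + ?c {x, w} = 0"
    if "distinct [x, y, z, w]" "{x, y, z, w} = ?W" for x y z w
  proof -
    have "vdeg a x = lookup a {x, y} + lookup a {x, z} + lookup a {x, w}"
      "vdeg b x = lookup b {x, y} + lookup b {x, z} + lookup b {x, w}"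
      by (rule vdeg_four[OF that(1)]; use edge that(2) in blast)+
    then show ?thesis using ab(3) by simp
  qed
  have "?c {p, q} + ?c {p, r} + ?c {p, s} = 0" "?c {p, q} + ?c {q, r} + ?c {q, s} = 0"
    "?c {p, r} + ?c {q, r} + ?c {r, s} = 0" "?c {p, s} + ?c {q, s} + ?c {r, s} = 0"
    using eq[of p q r s] eq[of q p r s] eq[of r p q s] eq[of s p q r] d Weq
    by (auto simp: insert_commute)
  then have c: "?c {p, q} = ?c {r, s}" "?c {p, r} = ?c {q, s}" "?c {p, s} = ?c {q, r}"
    "?c {p, r} < 0 \<or> ?c {p, s} < 0" using e[unfolded pq(1)] by linarith+
  have a: "{p, q} \<in> keys a" "{r, s} \<in> keys a"
    using c(1) e pq(1) by (auto simp: in_keys_iff)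
  from c(4) show ?thesis
  proof
    assume "?c {p, r} < 0"
    then have "{p, r} \<in> keys b" "{q, s} \<in> keys b" using c(2) by (auto simp: in_keys_iff)
    then show ?thesis by (rule exchange_in_proper_multiples[OF ab(1-3) t d a])
  next
    assume "?c {p, s} < 0"
    then have b: "{p, s} \<in> keys b" "{q, r} \<in> keys b" using c(3) by (auto simp: in_keys_iff)
    have "{s, r} \<in> keys a" using a(2) by (simp add: insert_commute)
    then show ?thesis
      using d by (intro exchange_in_proper_multiples[OF ab(1-3) t _ a(1) _ b]) auto
  qed
qed

section \<open>Complete intersections\<close>
lemma ex_generators_le:
  assumes "min_generators R I \<le> enat k"
  shows "\<exists>F. finite F \<and> F \<subseteq> carrier R \<and> Idl\<^bsub>R\<^esub> F = I \<and> card F \<le> k"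
proof -
  let ?A = "{enat (card S) | S. finite S \<and> S \<subseteq> carrier R \<and> Idl\<^bsub>R\<^esub> S = I}"
  have attained: "Inf A \<in> A" if "Inf A \<noteq> \<infinity>" for A :: "enat set"
    using that unfolding Inf_enat_def by (metis LeastI ex_in_conv)
  have "Inf ?A \<in> ?A"
    by (rule attained) (use assms in \<open>unfold min_generators_def, cases "Inf ?A", auto\<close>)
  then obtain F where "finite F" "F \<subseteq> carrier R" "Idl\<^bsub>R\<^esub> F = I" "Inf ?A = enat (card F)" by blast
  then show ?thesis using assms unfolding min_generators_def by auto
qed

lemma handshake:
  assumes G: "simple_graph V E"
  shows "(\<Sum>v\<in>V. vertex_degree E v) = 2 * card E"
proof -
  have fin: "finite V" "finite E" using G finite_edges by (auto simp: simple_graph_def)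
  have "(\<Sum>v\<in>V. vertex_degree E v) = (\<Sum>v\<in>V. \<Sum>e\<in>E. if v \<in> e then 1 else 0)"
    using fin by (simp add: vertex_degree_def sum.If_cases Int_def)
  also have "\<dots> = (\<Sum>e\<in>E. \<Sum>v\<in>V. if v \<in> e then 1 else 0)" by (rule sum.swap)
  also have "\<dots> = (\<Sum>e\<in>E. 2)"
  proof (rule sum.cong)
    fix e assume e: "e \<in> E"
    have "V \<inter> {v. v \<in> e} = e" using simple_graph_edge[OF G e] by auto
    then show "(\<Sum>v\<in>V. if v \<in> e then 1 else 0) = (2::nat)"
      using fin simple_graph_edge[OF G e] by (simp add: sum.If_cases)
  qed simp
  finally show ?thesis by simp
qed

lemma quadric_binomial:
  assumes "tdeg a = 2" "tdeg b = 2"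
  shows "quadric (single a 1 - single b (1::'k::field))"
proof -
  have "keys (single a 1 - single b (1::'k)) \<subseteq> {a, b}"
    by (auto simp: in_keys_iff lookup_minus lookup_single when_def split: if_splits)
  then show ?thesis using assms by (auto simp: quadric_def tdeg_def wsum_def)
qed

theorem corollary3p8:
  fixes V :: "'a set" and E :: "'a set set"
  assumes "simple_graph V E"
    and "complete_intersection TYPE('k::field) V E"
  shows "(\<exists>v\<in>V. vertex_degree E v \<le> 2) \<or>
    (regular_graph 3 V E \<and>
     (\<forall>v\<in>V. num_bipartite_components (V - {v}) (induced_edges E (V - {v})) = 0) \<and>
     (\<exists>Q :: ('a set, 'k) mpoly set. Q \<subseteq> carrier (mpoly_ring E) \<and> (\<forall>q\<in>Q. quadric q) \<and>
        toric_ideal V E = Idl\<^bsub>mpoly_ring E\<^esub> Q))"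
proof (cases "\<exists>v\<in>V. vertex_degree E v \<le> 2")
  case False
  then have deg: "3 \<le> vertex_degree E v" if "v \<in> V" for v using that by force
  note G = assms(1)
  have fin: "finite V" "finite E" "\<And>e. e \<in> E \<Longrightarrow> finite e"
    using G finite_edges simple_graph_edge by (auto simp: simple_graph_def)
  let ?T = "toric_set E :: ('a set, 'k) mpoly set"
  let ?r = incidence_rank
  let ?E = "\<lambda>v. {e \<in> E. v \<notin> e}"

  \<comment> \<open>The height bound makes the number of generators finite, so a smallest set of generators exists.\<close>
  have "min_generators (mpoly_ring E) ?T \<le> enat (card E - ?r E)"
    using assms(2) ideal_height_toric_le[OF G, where 'k='k]
    by (simp add: complete_intersection_def toric_ideal_eq[OF G])
  from ex_generators_le[OF this]
  obtain F where F: "finite F" "F \<subseteq> carrier (mpoly_ring E)" "Idl\<^bsub>mpoly_ring E\<^esub> F = ?T"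
    "card F \<le> card E - ?r E"
    by (elim exE conjE)
  obtain S :: "('a set, 'k) mpoly set" where S: "finite S" "card S \<le> card F" "S \<subseteq> binomials E"
    "?T = pm.span (monomial_multiples E S)" "\<And>s. s \<in> S \<Longrightarrow> s \<notin> pm.span (proper_multiples E)"
    by (rule minimal_binomial_generators[OF G F(1-3)], rule that)
  have S0: "0 \<notin> S" using S(5)[of 0] pm.span_zero by blast
  have gen: "binomials E \<subseteq> pm.span (monomial_multiples E S)"
    using S(4) pm.span_superset[of "binomials E :: ('a set, 'k) mpoly set"]
    unfolding toric_set_eq_span by simp

  have form: "\<exists>a b. s = single a 1 - single b 1 \<and> keys a \<subseteq> E \<and> keys b \<subseteq> E \<and> vdeg a = vdeg b \<and> a \<noteq> b \<and>
      poly_vertices s = {v. vdeg a v \<noteq> 0}" if s: "s \<in> S" for s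
  proof -
    obtain a b where ab: "s = single a 1 - single b 1" "keys a \<subseteq> E" "keys b \<subseteq> E" "vdeg a = vdeg b"
      using s S(3) unfolding binomials_def by blast
    moreover have "a \<noteq> b" using ab S0 s by auto
    ultimately show ?thesis using poly_vertices_binomial by blast
  qed
  have pv: "poly_vertices s \<subseteq> V" "4 \<le> card (poly_vertices s)" if s: "s \<in> S" for s
  proof -
    obtain a b where "keys a \<subseteq> E" "keys b \<subseteq> E" "vdeg a = vdeg b" "a \<noteq> b"
      "poly_vertices s = {v. vdeg a v \<noteq> 0}" using form[OF s] by blast
    then show "poly_vertices s \<subseteq> V" "4 \<le> card (poly_vertices s)"
      using four_le_card_binomial_vertices[OF G, of a b] by simp_all
  qed

  let ?k = "\<lambda>v. card {s \<in> S. v \<in> poly_vertices s}"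
  have nS: "card E \<le> card S + ?r E" by (rule card_edges_le_generators[OF fin(2,3) S(1,3) gen])
  have rE: "?r E \<le> card E"
    using incidence_basis[of E] fin card_mono by metis
  have rV: "?r E \<le> card V"
    using fin simple_graph_edge(2)[OF G] by (intro incidence_rank_le) auto
  have k: "?k v + ?r E \<le> vertex_degree E v + ?r (?E v)" and r: "?r (?E v) + 1 \<le> ?r E" if v: "v \<in> V" for v
  proof -
    let ?S = "{s \<in> S. v \<notin> poly_vertices s}"
    note del = toric_set_delete_vertex[OF S(3) S0 gen, of v]
    \<comment> \<open>Applied to the graph without \<open>v\<close> this bounds the binomials that avoid \<open>v\<close> from below.\<close>
    have 1: "card (?E v) \<le> card ?S + ?r (?E v)"
      using fin S(1) by (intro card_edges_le_generators[OF _ _ _ del]) auto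
    have "card E = card ({e \<in> E. v \<in> e} \<union> ?E v)" by (rule arg_cong[of _ _ card]) auto
    also have "\<dots> = vertex_degree E v + card (?E v)"
      unfolding vertex_degree_def using fin by (intro card_Un_disjoint) auto
    finally have 2: "card E = vertex_degree E v + card (?E v)" .
    have "card S = card ({s \<in> S. v \<in> poly_vertices s} \<union> ?S)" by (rule arg_cong[of _ _ card]) auto
    also have "\<dots> = ?k v + card ?S" using S(1) by (intro card_Un_disjoint) auto
    finally have 3: "card S = ?k v + card ?S" .
    show "?k v + ?r E \<le> vertex_degree E v + ?r (?E v)"
      using 1 2 3 S(2) F(4) rE by linarith
    have "{e \<in> E. v \<in> e} \<noteq> {}" using deg[OF v] unfolding vertex_degree_def by (metis card.empty not_numeral_le_zero)
    then show "?r (?E v) + 1 \<le> ?r E" using incidence_rank_delete_vertex[OF fin(2,3)] by blast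
  qed
  have k1: "?k v + 1 \<le> vertex_degree E v" if "v \<in> V" for v using k[OF that] r[OF that] by linarith

  \<comment> \<open>Double counting of the pairs of a vertex and a binomial that meets it.\<close>
  have "(\<Sum>v\<in>V. ?k v) = (\<Sum>v\<in>V. \<Sum>s\<in>S. if v \<in> poly_vertices s then 1 else 0)"
    using S(1) by (simp add: sum.If_cases Int_def)
  also have "\<dots> = (\<Sum>s\<in>S. \<Sum>v\<in>V. if v \<in> poly_vertices s then 1 else 0)" by (rule sum.swap)
  also have "\<dots> = (\<Sum>s\<in>S. card (poly_vertices s))"
  proof (rule sum.cong)
    fix s assume "s \<in> S"
    then have "V \<inter> {v. v \<in> poly_vertices s} = poly_vertices s" using pv by auto
    then show "(\<Sum>v\<in>V. if v \<in> poly_vertices s then 1 else 0) = card (poly_vertices s)"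
      using fin by (simp add: sum.If_cases)
  qed simp
  finally have count: "(\<Sum>v\<in>V. ?k v) = (\<Sum>s\<in>S. card (poly_vertices s))" .
  have four: "4 * card S \<le> (\<Sum>s\<in>S. card (poly_vertices s))"
    using sum_mono[of S "\<lambda>_. 4" "\<lambda>s. card (poly_vertices s)"] pv by simp
  have ksum: "(\<Sum>v\<in>V. ?k v + 1) = (\<Sum>v\<in>V. ?k v) + card V" by (simp only: sum.distrib) simp
  have kdeg: "(\<Sum>v\<in>V. ?k v) + card V \<le> 2 * card E"
    using sum_mono[of V "\<lambda>v. ?k v + 1" "vertex_degree E"] k1 unfolding ksum handshake[OF G] by blast
  have three: "3 * card V \<le> 2 * card E"
    using sum_mono[of V "\<lambda>_. 3" "vertex_degree E"] deg handshake[OF G] by simp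
  \<comment> \<open>Adding \<open>four\<close>, \<open>kdeg\<close>, \<open>three\<close> and four times \<open>nS\<close> and \<open>rV\<close> gives equal sides, so each is an equality.\<close>
  have eqs: "2 * card E = 3 * card V" "?r E = card V" "(\<Sum>s\<in>S. card (poly_vertices s)) = 4 * card S"
    "(\<Sum>v\<in>V. ?k v) + card V = 2 * card E"
    using nS rV count four kdeg three by linarith+

  have reg: "vertex_degree E v = 3" if "v \<in> V" for v
    using sum_mono_inv[of "\<lambda>_. 3" V "vertex_degree E" v] that deg fin handshake[OF G] eqs(1) by simp
  have kv: "?k v + 1 = vertex_degree E v" if "v \<in> V" for v
    using sum_mono_inv[of "\<lambda>v. ?k v + 1" V "vertex_degree E" v] that k1 fin(1)
    unfolding ksum handshake[OF G] eqs(4) by blast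
  have ps: "card (poly_vertices s) = 4" if "s \<in> S" for s
    using sum_mono_inv[of "\<lambda>_. 4" S "\<lambda>s. card (poly_vertices s)" s] that pv S(1) eqs(3) by simp

  have "num_bipartite_components (V - {v}) (induced_edges E (V - {v})) = 0" if v: "v \<in> V" for v
  proof -
    have E': "induced_edges E (V - {v}) = ?E v"
      using simple_graph_edge(2)[OF G] by (auto simp: induced_edges_def)
    have "simple_graph (V - {v}) (?E v)" using G by (fastforce simp: simple_graph_def)
    moreover have "?r (?E v) = card (V - {v})"
      using k[OF v] r[OF v] kv[OF v] eqs(2) v fin by simp
    ultimately show ?thesis unfolding E' by (rule no_bipartite_component)
  qed
  moreover have "quadric s" if s: "s \<in> S" for s
  proof -
    obtain a b where ab: "s = single a 1 - single b 1" "keys a \<subseteq> E" "keys b \<subseteq> E" "vdeg a = vdeg b" "a \<noteq> b"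
      "poly_vertices s = {v. vdeg a v \<noteq> 0}" using form[OF s] by blast
    have "4 = (\<Sum>v\<in>poly_vertices s. 1::nat)" using ps[OF s] by simp
    also have "\<dots> \<le> (\<Sum>v\<in>poly_vertices s. vdeg a v)" unfolding ab(6) by (intro sum_mono) auto
    also have "\<dots> \<le> (\<Sum>v\<in>V. vdeg a v)" using pv(1)[OF s] fin(1) by (intro sum_mono2) auto
    also have "\<dots> = 2 * tdeg a" by (rule sum_vdeg[OF G ab(2)])
    finally have "2 \<le> tdeg a" by simp
    moreover have "\<not> 2 < tdeg a"
      using binomial_on_four_vertices[OF G ab(2-5)] ps[OF s] S(5)[OF s] ab(1,6) by metis
    ultimately have "tdeg a = 2" by simp
    then show ?thesis
      unfolding ab(1) using tdeg_eq_if_vdeg_eq[OF G ab(2-4)] by (intro quadric_binomial) auto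
  qed
  moreover have "S \<subseteq> carrier (mpoly_ring E)"
    using S(3) pm.span_superset[of "binomials E"] unfolding toric_set_eq_span[symmetric]
    by (auto simp: toric_set_def)
  moreover from this have "toric_ideal V E = Idl\<^bsub>mpoly_ring E\<^esub> S"
    using S(4) by (simp add: toric_ideal_eq[OF G] genideal_eq_span)
  ultimately show ?thesis using reg unfolding regular_graph_def by blast
qed simp

end
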